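(* Let $m,n\ge 2$ be integers. For almost every (with respect to $(m-1)$-dimensional Lebesgue measure) point $(p_1,\dots,p_{m-1})$ of the set $\{(p_1,\dots,p_{m-1}) : p_i>0,\ \sum_{i=1}^{m-1}p_i<1\}$, the Bernoulli source with symbol probabilities $p_1,\dots,p_{m-1}$ and $p_m=1-\sum_{i=1}^{m-1}p_i$ has the following property: there exist constants $c>0$ and $N_0>1$ (depending on the source and on $n$) such that every decipherable word-based code from the source alphabet $\{a_1,\dots,a_m\}$ to the output alphabet $\{b_1,\dots,b_n\}$ with average delay $\bar N\ge N_0$ has redundancy $$R\ge c\,\bar N^{-9}(\ln\bar N)^{-8}.$$
   Context: A Bernoulli source produces independent symbols from the input alphabet $\{a_1,\dots,a_m\}$ with probabilities $p_1,\dots,p_m$; its entropy is $H=-\sum_{i=1}^m p_i\log_2 p_i$. A message is an infinite sequence of input symbols. For a word $A=a_{i_1}\cdots a_{i_k}$, $|A|=k$ is its length and $p(A)=p_{i_1}\cdots p_{i_k}$. A word-based code consists of a finite set of distinct nonempty words $A_1,A_2,\dots$ over the input alphabet such that every message can be uniquely represented as an infinite concatenation of words $A_j$ (in particular, the set is prefix-free and every message begins with one of its words), together with a map $\phi$ assigning to each $A_j$ a word $\phi(A_j)$ over the output alphabet $\{b_1,\dots,b_n\}$. The code is decipherable if $\phi(A_{i_1})\cdots\phi(A_{i_s})=\phi(A_{j_1})\cdots\phi(A_{j_t})$ always implies $s=t$ and $i_k=j_k$ for $k=1,\dots,s$. Average delay: $\bar N=\sum_j p(A_j)|A_j|$. Redundancy: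 $R=\bar N^{-1}\sum_j p(A_j)|\phi(A_j)|-H/\log_2 n$. *)

theory Defs
  imports "HOL-Analysis.Analysis" "HOL-Library.Stream"
begin

text \<open>Input letters are the numbers \<open>1, \<dots>, m\<close> and output letters the numbers
  \<open>1, \<dots>, n\<close>. Words are lists of letters, messages are streams of input letters.\<close>

text \<open>A point \<open>x\<close> only carries the first \<open>m - 1\<close> probabilities; the last one is determined
  by them.\<close>

definition source_prob :: "nat \<Rightarrow> (nat \<Rightarrow> real) \<Rightarrow> nat \<Rightarrow> real" where
  "source_prob m x i = (if i = m then 1 - (\<Sum>j\<in>{1..<m}. x j) else x i)"

definition source_entropy :: "nat \<Rightarrow> (nat \<Rightarrow> real) \<Rightarrow> real" where
  "source_entropy m p = - (\<Sum>i\<in>{1..m}. p i * log 2 (p i))"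

definition word_prob :: "(nat \<Rightarrow> real) \<Rightarrow> nat list \<Rightarrow> real" where
  "word_prob p A = prod_list (map p A)"

text \<open>The words \<open>A\<^sub>j\<close> form the set \<open>W\<close>. Since they are nonempty, \<open>flat ws\<close> is the infinite
  concatenation of the words of the stream \<open>ws\<close>. Prefix-freeness need not be required: if
  \<open>u\<close> and \<open>u @ v\<close> were distinct words of \<open>W\<close>, any message starting with \<open>u @ v\<close> would have
  two representations. Only the values of \<open>\<phi>\<close> on \<open>W\<close> matter.\<close>

definition word_based_code ::
    "nat \<Rightarrow> nat \<Rightarrow> nat list set \<Rightarrow> (nat list \<Rightarrow> nat list) \<Rightarrow> bool" where
  "word_based_code m n W \<phi> \<longleftrightarrow>
     finite W \<and> W \<subseteq> lists {1..m} \<and> [] \<notin> W \<and>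
     (\<forall>s\<in>streams {1..m}. \<exists>!ws. ws \<in> streams W \<and> flat ws = s) \<and>
     (\<forall>A\<in>W. \<phi> A \<in> lists {1..n})"

definition decipherable :: "nat list set \<Rightarrow> (nat list \<Rightarrow> nat list) \<Rightarrow> bool" where
  "decipherable W \<phi> \<longleftrightarrow>
     (\<forall>us\<in>lists W. \<forall>vs\<in>lists W. concat (map \<phi> us) = concat (map \<phi> vs) \<longrightarrow> us = vs)"

definition average_delay :: "(nat \<Rightarrow> real) \<Rightarrow> nat list set \<Rightarrow> real" where
  "average_delay p W = (\<Sum>A\<in>W. word_prob p A * real (length A))"

definition redundancy ::
    "nat \<Rightarrow> nat \<Rightarrow> (nat \<Rightarrow> real) \<Rightarrow> nat list set \<Rightarrow> (nat list \<Rightarrow> nat list) \<Rightarrow> real" where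
  "redundancy m n p W \<phi> =
     inverse (average_delay p W) * (\<Sum>A\<in>W. word_prob p A * real (length (\<phi> A)))
       - source_entropy m p / log 2 (real n)"

text \<open>\<open>k\<close>-dimensional Lebesgue measure on functions with domain \<open>{1..k}\<close>, the dimension being
  a term rather than a type. The completion mirrors \<^term>\<open>lebesgue\<close>.\<close>

definition lebesgue_dim :: "nat \<Rightarrow> (nat \<Rightarrow> real) measure" where
  "lebesgue_dim k = completion (Pi\<^sub>M {1..k} (\<lambda>_. lborel))"

end

theory Submission
  imports Defs
begin

text \<open>By the Kraft--McMillan inequality and the Wald identity for the complete prefix-free set \<open>W\<close>,
  \<open>R \<cdot> N \<cdot> ln n\<close> is at least \<open>\<Sum>A. p(A) (exp(-y\<^sub>A) - 1 + y\<^sub>A)\<close> where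
  \<open>y\<^sub>A = |\<phi>(A)| ln n + ln p(A)\<close>, hence at least a constant times
  \<open>\<Sum>A. p(A) d\<^sub>A\<^sup>2\<close>, where \<open>d\<^sub>A\<close> is the distance of \<open>ln p(A)\<close> to the lattice
  \<open>\<int> ln n\<close>. It suffices that \<open>d\<^sub>A \<ge> const \<cdot> N\<^sup>-\<^sup>4\<close> on a set of words \<open>A\<close> of probability
  at least \<open>1/4\<close>.

  Let \<open>F\<^sub>K\<close> be the probability that a random word \<open>w\<close> of length \<open>K\<close> has \<open>ln p(w)\<close> within
  \<open>K\<^sup>-\<^sup>4\<close> of the lattice. For almost every source \<open>\<Sum>K. F\<^sub>K\<close> is finite: move one probability
  \<open>t\<close> with the sum \<open>s\<close> of it and the last one fixed. Words with a common merged word (the two letters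
  identified, \<open>L\<close> occurrences) and the same number of occurrences of the last letter have total probability
  \<open>exp(G(t))\<close> with \<open>G \<le> 0\<close> and \<open>G'' \<le> -L\<close>. A band of width \<open>\<epsilon>\<close> of such a concave \<open>G\<close>
  has measure \<open>O(sqrt(\<epsilon>/L))\<close>, and the weight \<open>exp(G)\<close> makes the sum over all lattice points
  geometric. The \<open>L + 1\<close> possible numbers of occurrences give \<open>O(sqrt(K \<epsilon>))\<close>, which is summable for
  \<open>\<epsilon> = K\<^sup>-\<^sup>4\<close>. Words of bounded length only need that \<open>ln p(w)\<close> is not in the lattice, and
  Markov's inequality discards the words longer than \<open>2N\<close>.\<close>

section \<open>Words and complete codes\<close>

definition words :: "'a set \<Rightarrow> nat \<Rightarrow> 'a list set" where
  "words S K = {w. set w \<subseteq> S \<and> length w = K}"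

lemma finite_words: "finite S \<Longrightarrow> finite (words S K)"
  unfolding words_def by (rule finite_lists_length_eq)

lemma words_0: "words S 0 = {[]}"
  by (auto simp: words_def)

lemma sum_words_Suc:
  assumes "finite S"
  shows "(\<Sum>w\<in>words S (Suc K). f w) = (\<Sum>a\<in>S. \<Sum>w\<in>words S K. f (a # w))"
proof -
  have eq: "words S (Suc K) = (\<lambda>(a, w). a # w) ` (S \<times> words S K)"
    unfolding words_def by (auto simp: image_iff length_Suc_conv)
  have "inj_on (\<lambda>(a, w). a # w) (S \<times> words S K)"
    by (auto simp: inj_on_def)
  then show ?thesis
    unfolding eq by (subst sum.reindex) (auto simp: sum.cartesian_product case_prod_unfold)
qed

lemma sum_prod_list_words:
  fixes p :: "'a \<Rightarrow> 'b::comm_semiring_1"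
  assumes "finite S"
  shows "(\<Sum>w\<in>words S K. prod_list (map p w)) = sum p S ^ K"
  proof (induction K)
  case (Suc K)
  then show ?case
    by (simp add: sum_words_Suc[OF assms] sum_distrib_right flip: sum_distrib_left)
qed (simp add: words_0)

text \<open>Independence of the letters: splitting off the first one leaves a centred letter value
  times total weight 1, plus the same mean for the shorter word.\<close>

lemma sum_prod_list_sum_list_words:
  fixes p f :: "'a \<Rightarrow> real"
  assumes "finite S" "sum p S = 1" "(\<Sum>a\<in>S. p a * f a) = 0"
  shows "(\<Sum>w\<in>words S K. prod_list (map p w) * sum_list (map f w)) = 0"
proof (induction K)
  case (Suc K)
  have "(\<Sum>w\<in>words S (Suc K). prod_list (map p w) * sum_list (map f w)) =
    (\<Sum>a\<in>S. (p a * f a) * (\<Sum>w\<in>words S K. prod_list (map p w))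
            + p a * (\<Sum>w\<in>words S K. prod_list (map p w) * sum_list (map f w)))"
    unfolding sum_words_Suc[OF assms(1)]
    by (rule sum.cong) (auto simp: sum_distrib_left sum.distrib[symmetric] algebra_simps intro!: sum.cong)
  also have "\<dots> = (\<Sum>a\<in>S. p a * f a)"
    by (simp add: Suc sum_prod_list_words[OF assms(1)] assms(2))
  finally show ?case using assms by simp
qed (simp add: words_0)

section \<open>Averages over the words of a complete code\<close>

lemma word_prob_append: "word_prob p (A @ B) = word_prob p A * word_prob p B"
  by (simp add: word_prob_def)

lemma word_prob_pos:
  assumes "\<And>a. a \<in> set w \<Longrightarrow> 0 < p a"
  shows "0 < word_prob p w"
  using assms by (induction w) (auto simp: word_prob_def)

lemma ln_word_prob:
  assumes "\<And>a. a \<in> set w \<Longrightarrow> 0 < p a"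
  shows "ln (word_prob p w) = sum_list (map (\<lambda>a. ln (p a)) w)"
  using assms
proof (induction w)
  case (Cons a w)
  have "0 < word_prob p w" using Cons.prems by (intro word_prob_pos) auto
  moreover have "0 < p a" using Cons.prems by simp
  ultimately show ?case using Cons by (auto simp: word_prob_def ln_mult less_imp_neq[symmetric])
qed (simp add: word_prob_def)

text \<open>Pad a finite word with the letter 1 to a message. The first code word of its
  representation has length at most \<open>D\<close>, hence is a prefix of the word: surjectivity.
  Two factorizations of one word would give two representations of one padded message:
  injectivity.\<close>

lemma word_based_code_bij:
  assumes code: "word_based_code m n W \<phi>" and m: "m \<ge> 1"
    and D: "\<And>A. A \<in> W \<Longrightarrow> length A \<le> D"
  shows "bij_betw (\<lambda>(A, u). A @ u) (SIGMA A:W. words {1..m} (D - length A)) (words {1..m} D)"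
proof -
  have W: "W \<subseteq> lists {1..m}" "[] \<notin> W"
    and ex: "\<And>s. s \<in> streams {1..m} \<Longrightarrow> \<exists>!ws. ws \<in> streams W \<and> flat ws = s"
    using code by (auto simp: word_based_code_def)
  have ext: "u @- sconst 1 \<in> streams {1..m}" if "set u \<subseteq> {1..m}" for u
    using that m by (intro shift_streams) (auto simp: streams_iff_sset)
  have inj: "A = B" if AB: "A \<in> W" "B \<in> W" "set u \<subseteq> {1..m}" "set v \<subseteq> {1..m}" "A @ u = B @ v"
    for A B u v
  proof -
    obtain us where us: "us \<in> streams W" "flat us = u @- sconst 1" using ex[OF ext[OF AB(3)]] by blast
    obtain vs where vs: "vs \<in> streams W" "flat vs = v @- sconst 1" using ex[OF ext[OF AB(4)]] by blast
    have ne: "A \<noteq> []" "B \<noteq> []" using AB W by auto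
    have "flat (A ## us) = (A @ u) @- sconst 1" using ne us by (simp add: flat_Stream)
    moreover have "flat (B ## vs) = (B @ v) @- sconst 1" using ne vs by (simp add: flat_Stream)
    moreover have "set (A @ u) \<subseteq> {1..m}" using AB W by auto
    moreover have "A ## us \<in> streams W" "B ## vs \<in> streams W" using AB us vs by (auto simp: streams_Stream)
    ultimately have "A ## us = B ## vs" using ex[OF ext, of "A @ u"] AB(5) by metis
    then show ?thesis by simp
  qed
  show ?thesis
  proof (rule bij_betw_imageI)
    show "inj_on (\<lambda>(A, u). A @ u) (SIGMA A:W. words {1..m} (D - length A))"
    proof (rule inj_onI, clarify)
      fix A u B v
      assume "A \<in> W" "B \<in> W" "u \<in> words {1..m} (D - length A)" "v \<in> words {1..m} (D - length B)"
        and eq: "A @ u = B @ v"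
      then have "A = B" by (intro inj[of A B u v]) (auto simp: words_def)
      with eq show "A = B \<and> u = v" by simp
    qed
    show "(\<lambda>(A, u). A @ u) ` (SIGMA A:W. words {1..m} (D - length A)) = words {1..m} D" (is "?L = _")
    proof
      show "?L \<subseteq> words {1..m} D"
      proof clarify
        fix A u assume "A \<in> W" "u \<in> words {1..m} (D - length A)"
        then show "A @ u \<in> words {1..m} D" using W(1) D[of A] by (auto simp: words_def)
      qed
      show "words {1..m} D \<subseteq> ?L"
      proof
        fix v assume v: "v \<in> words {1..m} D"
        then obtain ws where ws: "ws \<in> streams W" "flat ws = v @- sconst 1"
          using ex[OF ext[of v]] by (auto simp: words_def)
        define A where "A = shd ws"
        have A: "A \<in> W" using ws(1) by (metis A_def streams_shd)
        with W have "A \<noteq> []" by auto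
        then have "A @- flat (stl ws) = v @- sconst 1"
          using ws(2) by (metis A_def flat_unfold)
        then have "stake (length A) (A @- flat (stl ws)) = stake (length A) (v @- sconst 1)" by simp
        then have "A = take (length A) v" using D[OF A] v by (simp add: stake_shift words_def)
        then obtain u where "v = A @ u" by (metis append_take_drop_id)
        then show "v \<in> ?L" using A v by (force simp: words_def)
      qed
    qed
  qed
qed

text \<open>By \<open>word_based_code_bij\<close> a random word of length \<open>D\<close> is a code
  word followed by an independent random tail. Tails have total probability 1, and a centred sum has
  mean 0 over full words and over tails, so it has mean 0 over \<open>W\<close>. The second claim is
  the Wald identity in centred form.\<close>

lemma sum_over_code:
  fixes p :: "nat \<Rightarrow> real"
  assumes code: "word_based_code m n W \<phi>" and m: "m \<ge> 1" and p: "sum p {1..m} = 1"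
  shows "(\<Sum>A\<in>W. word_prob p A) = 1"
    and "(\<Sum>a\<in>{1..m}. p a * f a) = 0 \<Longrightarrow> (\<Sum>A\<in>W. word_prob p A * sum_list (map f A)) = 0"
proof -
  have fin: "finite W" using code by (auto simp: word_based_code_def)
  define D where "D = Max (insert 0 (length ` W))"
  have D: "\<And>A. A \<in> W \<Longrightarrow> length A \<le> D" using fin by (auto simp: D_def)
  have *: "(\<Sum>v\<in>words {1..m} D. h v) = (\<Sum>A\<in>W. \<Sum>u\<in>words {1..m} (D - length A). h (A @ u))"
    for h :: "nat list \<Rightarrow> real"
    by (subst sum.reindex_bij_betw[OF word_based_code_bij[OF code m D], symmetric])
       (auto simp: sum.Sigma fin finite_words case_prod_unfold)
  have tot: "(\<Sum>u\<in>words {1..m} k. word_prob p u) = 1" for k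
    unfolding word_prob_def by (simp only: sum_prod_list_words finite_atLeastAtMost p power_one)
  show "(\<Sum>A\<in>W. word_prob p A) = 1"
    using *[of "word_prob p"] by (simp add: tot word_prob_append del: One_nat_def flip: sum_distrib_left)
  assume f: "(\<Sum>a\<in>{1..m}. p a * f a) = 0"
  have zero: "(\<Sum>u\<in>words {1..m} k. word_prob p u * sum_list (map f u)) = 0" for k
    unfolding word_prob_def by (rule sum_prod_list_sum_list_words) (use p f in auto)
  have "0 = (\<Sum>A\<in>W. \<Sum>u\<in>words {1..m} (D - length A). word_prob p (A @ u) * sum_list (map f (A @ u)))"
    using *[of "\<lambda>v. word_prob p v * sum_list (map f v)"] zero by simp
  also have "\<dots> = (\<Sum>A\<in>W. \<Sum>u\<in>words {1..m} (D - length A).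
      word_prob p A * sum_list (map f A) * word_prob p u +
      word_prob p A * (word_prob p u * sum_list (map f u)))"
    by (intro sum.cong refl) (simp add: word_prob_append algebra_simps)
  also have "\<dots> = (\<Sum>A\<in>W. word_prob p A * sum_list (map f A))"
    by (simp add: sum.distrib tot zero del: One_nat_def flip: sum_distrib_left)
  finally show "(\<Sum>A\<in>W. word_prob p A * sum_list (map f A)) = 0" by simp
qed

section \<open>The Kraft-McMillan inequality and the redundancy\<close>

lemma kraft_mcmillan:
  assumes dec: "decipherable W \<phi>" and fin: "finite W" and n: "n \<ge> 1"
    and \<phi>: "\<And>A. A \<in> W \<Longrightarrow> \<phi> A \<in> lists {1..n}"
  shows "(\<Sum>A\<in>W. (1 / real n) ^ length (\<phi> A)) \<le> 1"
proof (rule ccontr)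
  define Z where "Z = (\<Sum>A\<in>W. (1 / real n) ^ length (\<phi> A))"
  define M where "M = Max (insert 0 (length ` \<phi> ` W))"
  have M: "length (\<phi> A) \<le> M" if "A \<in> W" for A using that fin by (auto simp: M_def)
  assume "\<not> ?thesis"
  then have Z: "Z > 1" by (simp add: Z_def)
  \<comment> \<open>McMillan's argument: \<open>Z ^ t\<close> is a sum over strings of
    \<open>t\<close> code words. Decipherability makes their encodings distinct, the encodings have
    length at most \<open>t * M\<close>, and all output words of one length have total weight 1. So
    \<open>Z ^ t\<close> grows at most linearly.\<close>
  have bound: "Z ^ t \<le> real (t * M + 1)" for t
  proof -
    let ?c = "\<lambda>us. concat (map \<phi> us)"
    have inj: "inj_on ?c (words W t)"
      using dec by (auto simp: decipherable_def inj_on_def words_def in_lists_conv_set)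
    have len: "length (?c us) \<le> length us * M" if "set us \<subseteq> W" for us
      using that by (induction us) (auto intro!: add_mono M)
    have pl: "prod_list (map (\<lambda>A. (1 / real n) ^ length (\<phi> A)) us) = (1 / real n) ^ length (?c us)" for us
      by (induction us) (simp_all add: power_add)
    have sub: "?c ` words W t \<subseteq> (\<Union>l\<in>{..t * M}. words {1..n} l)"
    proof safe
      fix us assume "us \<in> words W t"
      then have us: "set us \<subseteq> W" "length us = t" by (auto simp: words_def)
      have "set (?c us) \<subseteq> {1..n}" using us \<phi> by (fastforce simp: in_lists_conv_set)
      then show "?c us \<in> (\<Union>l\<in>{..t * M}. words {1..n} l)" using len[OF us(1)] us(2) by (auto simp: words_def)
    qed
    have "Z ^ t = (\<Sum>us\<in>words W t. (1 / real n) ^ length (?c us))"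
      unfolding Z_def sum_prod_list_words[OF fin, symmetric] pl ..
    also have "\<dots> = (\<Sum>z\<in>?c ` words W t. (1 / real n) ^ length z)"
      by (simp add: sum.reindex[OF inj])
    also have "\<dots> \<le> (\<Sum>z\<in>(\<Union>l\<in>{..t * M}. words {1..n} l). (1 / real n) ^ length z)"
      by (intro sum_mono2 sub) (auto intro: finite_words)
    also have "\<dots> = (\<Sum>l\<le>t * M. \<Sum>z\<in>words {1..n} l. (1 / real n) ^ length z)"
      by (subst sum.UNION_disjoint) (auto simp: finite_words, auto simp: words_def)
    also have "\<dots> = (\<Sum>l\<le>t * M. \<Sum>z\<in>words {1..n} l. prod_list (map (\<lambda>_. 1 / real n) z))"
      by (simp add: map_replicate_const)
    also have "\<dots> = (\<Sum>l\<le>t * M. 1)"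
      using n by (simp add: sum_prod_list_words)
    finally show ?thesis by simp
  qed
  \<comment> \<open>The linear bound divided by \<open>Z ^ t\<close> tends to 0 but never drops
    below 1.\<close>
  have "(\<lambda>t. real t * (1 / Z) ^ t * M + (1 / Z) ^ t) \<longlonglongrightarrow> 0 * real M + 0"
    using Z by (intro tendsto_intros powser_times_n_limit_0 LIMSEQ_power_zero) auto
  moreover have "1 \<le> real t * (1 / Z) ^ t * M + (1 / Z) ^ t" for t
    using bound[of t] Z by (simp add: power_divide field_simps)
  ultimately have "1 \<le> 0 * real M + 0" by (intro LIMSEQ_le_const) auto
  then show False by simp
qed

text \<open>For \<open>y \<le> 2\<close>, squaring \<open>1 - y / 2 \<le> exp (- y / 2)\<close>
  leaves a surplus of a quarter of the square of \<open>y\<close>. For larger \<open>y\<close> the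
  left side already exceeds 1.\<close>

lemma exp_minus_ge:
  fixes y \<epsilon> :: real
  assumes "\<bar>y\<bar> \<ge> \<epsilon>" "0 \<le> \<epsilon>" "\<epsilon> \<le> 1"
  shows "exp (- y) - 1 + y \<ge> \<epsilon>\<^sup>2 / 4"
proof (cases "y \<le> 2")
  case True
  have "(1 - y / 2)\<^sup>2 \<le> (exp (- y / 2))\<^sup>2"
    using True exp_ge_add_one_self[of "- y / 2"] by (intro power_mono) auto
  also have "\<dots> = exp (- y)" by (simp flip: exp_double)
  finally have "y\<^sup>2 / 4 \<le> exp (- y) - 1 + y" by (simp add: power2_eq_square algebra_simps)
  moreover have "\<epsilon>\<^sup>2 \<le> y\<^sup>2" using assms by (metis power2_abs power_mono)
  ultimately show ?thesis by simp
next
  case False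
  have "\<epsilon>\<^sup>2 \<le> 1" using assms by (simp add: power_le_one)
  with False show ?thesis using exp_gt_zero[of "- y"] by linarith
qed

text \<open>The existential over the integers makes nearness a countable union of open conditions,
  so its measurability is immediate.\<close>

definition near :: "real \<Rightarrow> real \<Rightarrow> real \<Rightarrow> bool" where
  "near \<beta> \<epsilon> y \<longleftrightarrow> (\<exists>j::int. \<bar>y - of_int j * \<beta>\<bar> < \<epsilon>)"

text \<open>The Wald identity turns the left side into the mean of \<open>y\<close>, and
  Kraft-McMillan bounds the mean of \<open>exp (- y)\<close> by 1. So the mean of \<open>y\<close>
  dominates that of \<open>exp (- y) - 1 + y\<close>. This is nonnegative for each word, so the sum
  may be restricted to any \<open>V\<close>, which allows badly placed words to be
  discarded.\<close>

lemma redundancy_ge: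
  fixes p :: "nat \<Rightarrow> real"
  assumes code: "word_based_code m n W \<phi>" and dec: "decipherable W \<phi>"
    and m: "m \<ge> 1" and n: "n \<ge> 2"
    and p: "sum p {1..m} = 1" "\<And>a. a \<in> {1..m} \<Longrightarrow> 0 < p a"
    and N: "average_delay p W > 0"
    and V: "V \<subseteq> W" and \<epsilon>: "0 \<le> \<epsilon>" "\<epsilon> \<le> 1"
    and far: "\<And>A. A \<in> V \<Longrightarrow> \<not> near (ln (real n)) \<epsilon> (ln (word_prob p A))"
  shows "redundancy m n p W \<phi> * average_delay p W * ln (real n) \<ge> (\<Sum>A\<in>V. word_prob p A) * (\<epsilon>\<^sup>2 / 4)"
proof -
  \<comment> \<open>\<open>E\<close> is minus the entropy in natural units; subtracting it centres
    \<open>ln (p a)\<close> for the Wald identity.\<close>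
  define E where "E = (\<Sum>a\<in>{1..m}. p a * ln (p a))"
  define y where "y A = real (length (\<phi> A)) * ln (real n) + ln (word_prob p A)" for A
  have fin: "finite W" and W: "W \<subseteq> lists {1..m}"
    and \<phi>: "\<And>A. A \<in> W \<Longrightarrow> \<phi> A \<in> lists {1..n}"
    using code by (auto simp: word_based_code_def)
  have lnn: "ln (real n) > 0" using n by simp
  have pos: "word_prob p A > 0" if "A \<in> W" for A
    using that W p(2) by (intro word_prob_pos) blast
  have lnA: "ln (word_prob p A) = sum_list (map (\<lambda>a. ln (p a) - E) A) + real (length A) * E" if "A \<in> W" for A
  proof -
    have "ln (word_prob p A) = sum_list (map (\<lambda>a. ln (p a)) A)"
      using that W p(2) by (intro ln_word_prob) blast
    also have "\<dots> = sum_list (map (\<lambda>a. ln (p a) - E) A) + real (length A) * E"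
      by (induction A) (simp_all add: algebra_simps)
    finally show ?thesis .
  qed
  have "(\<Sum>a\<in>{1..m}. p a * (ln (p a) - E)) = E - sum p {1..m} * E"
    unfolding E_def by (simp add: algebra_simps sum_subtractf sum_distrib_right)
  then have "(\<Sum>A\<in>W. word_prob p A * sum_list (map (\<lambda>a. ln (p a) - E) A)) = 0"
    using sum_over_code(2)[OF code m p(1)] p(1) by simp
  then have wald: "(\<Sum>A\<in>W. word_prob p A * ln (word_prob p A)) = average_delay p W * E"
    by (simp add: lnA average_delay_def algebra_simps sum.distrib sum_distrib_left)
  have ent: "source_entropy m p / log 2 (real n) * ln (real n) = - E"
    using lnn by (simp add: source_entropy_def E_def log_def sum_divide_distrib[symmetric])
  have "redundancy m n p W \<phi> * average_delay p W * ln (real n)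
      = (\<Sum>A\<in>W. word_prob p A * real (length (\<phi> A))) * ln (real n)
        - average_delay p W * (source_entropy m p / log 2 (real n) * ln (real n))"
    unfolding redundancy_def using N by (simp add: field_simps)
  also have "\<dots> = (\<Sum>A\<in>W. word_prob p A * y A)"
    unfolding ent y_def by (simp add: algebra_simps sum.distrib sum_distrib_left sum_distrib_right wald)
  finally have R: "redundancy m n p W \<phi> * average_delay p W * ln (real n) = (\<Sum>A\<in>W. word_prob p A * y A)" .
  have kr: "(\<Sum>A\<in>W. word_prob p A * exp (- y A)) \<le> 1"
  proof -
    have "word_prob p A * exp (- y A) = (1 / real n) ^ length (\<phi> A)" if "A \<in> W" for A
      using pos[OF that] n
      by (simp add: y_def exp_diff exp_of_nat_mult exp_minus divide_simps)
    then have "(\<Sum>A\<in>W. word_prob p A * exp (- y A)) = (\<Sum>A\<in>W. (1 / real n) ^ length (\<phi> A))" by simp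
    then show ?thesis using kraft_mcmillan[OF dec fin _ \<phi>] n by simp
  qed
  have "(\<Sum>A\<in>V. word_prob p A) * (\<epsilon>\<^sup>2 / 4) = (\<Sum>A\<in>V. word_prob p A * (\<epsilon>\<^sup>2 / 4))"
    by (rule sum_distrib_right)
  also have "\<dots> \<le> (\<Sum>A\<in>V. word_prob p A * (exp (- y A) - 1 + y A))"
  proof (intro sum_mono mult_left_mono exp_minus_ge \<epsilon>)
    fix A assume A: "A \<in> V"
    \<comment> \<open>\<open>y A\<close> is the difference between \<open>ln (word_prob p A)\<close>
      and the lattice point of index \<open>- int (length (\<phi> A))\<close>.\<close>
    show "\<bar>y A\<bar> \<ge> \<epsilon>"
      using far[OF A] unfolding near_def
      by (auto simp: not_less y_def add.commute dest: spec[of _ "- int (length (\<phi> A))"])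
    show "0 \<le> word_prob p A" using pos A V by (meson less_imp_le subsetD)
  qed
  also have "\<dots> \<le> (\<Sum>A\<in>W. word_prob p A * (exp (- y A) - 1 + y A))"
  proof (intro sum_mono2 fin V mult_nonneg_nonneg)
    fix A assume "A \<in> W - V"
    then show "0 \<le> word_prob p A" using pos by (meson DiffD1 less_imp_le)
    show "0 \<le> exp (- y A) - 1 + y A" using exp_ge_add_one_self[of "- y A"] by simp
  qed
  also have "\<dots> = (\<Sum>A\<in>W. word_prob p A * exp (- y A)) - (\<Sum>A\<in>W. word_prob p A) + (\<Sum>A\<in>W. word_prob p A * y A)"
    by (simp add: algebra_simps sum.distrib sum_subtractf)
  also have "\<dots> \<le> (\<Sum>A\<in>W. word_prob p A * y A)"
    using kr sum_over_code(1)[OF code m p(1)] by simp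
  finally show ?thesis unfolding R .
qed

section \<open>Bands of concave functions\<close>

text \<open>The hypothesis expresses \<open>G'' \<le> - L\<close> without derivatives. By strong
  concavity no point of the band is farther than \<open>d = 2 * sqrt (\<epsilon> / L)\<close> from
  both ends of the band, so two intervals of length \<open>d\<close> cover it.\<close>

lemma emeasure_concave_band:
  fixes G :: "real \<Rightarrow> real"
  assumes conc: "concave_on {0<..<s} (\<lambda>t. G t + L / 2 * t\<^sup>2)" and L: "L > 0" and \<epsilon>: "\<epsilon> > 0"
  shows "emeasure lborel {t \<in> {0<..<s}. \<bar>G t - c\<bar> < \<epsilon>} \<le> ennreal (4 * sqrt (\<epsilon> / L))"
proof (cases "{t \<in> {0<..<s}. \<bar>G t - c\<bar> < \<epsilon>} = {}")
  case False
  define T where "T = {t \<in> {0<..<s}. \<bar>G t - c\<bar> < \<epsilon>}"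
  define d where "d = 2 * sqrt (\<epsilon> / L)"
  have d: "d \<ge> 0" "d * d = 4 * \<epsilon> / L" using \<epsilon> L by (simp_all add: d_def)
  \<comment> \<open>Strong concavity lifts \<open>G t2\<close> above the chord by at least
    \<open>L / 2 * ((t2 - t1) * (t3 - t2))\<close>, while the band leaves room for less than
    \<open>2 * \<epsilon>\<close>.\<close>
  have three: "(t2 - t1) * (t3 - t2) < 4 * \<epsilon> / L"
    if t: "t1 \<in> T" "t2 \<in> T" "t3 \<in> T" "t1 < t2" "t2 < t3" for t1 t2 t3
  proof -
    define u where "u = (t3 - t2) / (t3 - t1)"
    have u: "0 \<le> u" "u \<le> 1" using t by (simp_all add: u_def)
    have t2: "t2 = t3 + u * (t1 - t3)" using t by (simp add: u_def field_simps)
    have "- (G t2 + L / 2 * t2\<^sup>2) \<le> u * - (G t1 + L / 2 * t1\<^sup>2) + (1 - u) * - (G t3 + L / 2 * t3\<^sup>2)"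
    proof -
      have "u *\<^sub>R t1 + (1 - u) *\<^sub>R t3 = t2" by (simp add: t2 algebra_simps)
      then show ?thesis
        using convex_onD[OF conc[unfolded concave_on_def], of "1 - u" t1 t3] t u by (simp add: T_def)
    qed
    moreover have "u * (c - \<epsilon>) + (1 - u) * (c - \<epsilon>) \<le> u * G t1 + (1 - u) * G t3"
      using u t by (intro add_mono mult_left_mono) (auto simp: T_def)
    moreover have "G t2 < c + \<epsilon>" using t by (auto simp: T_def)
    moreover have "u * (L / 2 * t1\<^sup>2) + (1 - u) * (L / 2 * t3\<^sup>2) - L / 2 * t2\<^sup>2 = L / 2 * ((t2 - t1) * (t3 - t2))"
      unfolding t2 by (simp add: power2_eq_square field_simps)
    ultimately have "L / 2 * ((t2 - t1) * (t3 - t2)) < 2 * \<epsilon>"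
      by (simp add: algebra_simps)
    then show ?thesis using L by (simp add: field_simps)
  qed
  have bdd: "bdd_below T" "bdd_above T"
    by (auto simp: T_def intro!: bdd_belowI[of _ 0] bdd_aboveI[of _ s])
  have ne: "T \<noteq> {}" using False by (simp add: T_def)
  have "T \<subseteq> {Inf T..Inf T + d} \<union> {Sup T - d..Sup T}"
  proof
    fix t assume t: "t \<in> T"
    show "t \<in> {Inf T..Inf T + d} \<union> {Sup T - d..Sup T}"
    proof (rule ccontr)
      assume "\<not> ?thesis"
      then have "Inf T < t - d" "t + d < Sup T"
        using cInf_lower[OF t bdd(1)] cSup_upper[OF t bdd(2)] by auto
      then obtain t1 t3 where t13: "t1 \<in> T" "t1 < t - d" "t3 \<in> T" "t + d < t3"
        using cInf_lessD[OF ne] less_cSupD[OF ne] by metis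
      then have "d * d \<le> (t - t1) * (t3 - t)" using d by (intro mult_mono) auto
      then show False using three[OF t13(1) t t13(3)] t13 d by auto
    qed
  qed
  then have "emeasure lborel T \<le> emeasure lborel ({Inf T..Inf T + d} \<union> {Sup T - d..Sup T})"
    by (intro emeasure_mono) auto
  also have "\<dots> \<le> emeasure lborel {Inf T..Inf T + d} + emeasure lborel {Sup T - d..Sup T}"
    by (intro emeasure_subadditive) auto
  also have "\<dots> = ennreal (4 * sqrt (\<epsilon> / L))"
    using d by (simp add: d_def flip: ennreal_plus)
  finally show ?thesis by (simp add: T_def)
next
  case True
  then show ?thesis by (metis emeasure_empty zero_le)
qed

lemma ennreal_term_le_suminf: "(h i :: ennreal) \<le> (\<Sum>i. h i)"
  using sum_le_suminf[of h "{i}"] by simp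

text \<open>Each lattice point contributes a band of measure at most
  \<open>4 * sqrt (\<epsilon> / L)\<close>. As \<open>G \<le> 0\<close>, there is a highest relevant
  lattice point, and each step of length \<open>\<beta>\<close> below it costs a factor
  \<open>exp (- \<beta>)\<close> in the integrand: a geometric series.\<close>

lemma nn_integral_exp_near_le:
  fixes G :: "real \<Rightarrow> real"
  assumes conc: "concave_on {0<..<s} (\<lambda>t. G t + L / 2 * t\<^sup>2)" and L: "L > 0"
    and \<epsilon>: "0 < \<epsilon>" "\<epsilon> \<le> 1" and \<beta>: "\<beta> > 0"
    and neg: "\<And>t. t \<in> {0<..<s} \<Longrightarrow> G t \<le> 0"
    and [measurable]: "G \<in> borel_measurable borel"
  shows "(\<integral>\<^sup>+t. ennreal (exp (G t)) * indicator {t \<in> {0<..<s}. near \<beta> \<epsilon> (G t + c)} t \<partial>lborel)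
    \<le> ennreal (4 * exp 2 / (1 - exp (- \<beta>)) * sqrt (\<epsilon> / L))"
proof -
  \<comment> \<open>\<open>J\<close> indexes the highest lattice point that \<open>G t + c\<close>
    can approach, and \<open>T i\<close> is the band \<open>i\<close> steps below it.\<close>
  define J where "J = \<lfloor>(c + \<epsilon>) / \<beta>\<rfloor>"
  define T where "T i = {t \<in> {0<..<s}. \<bar>G t - ((of_int J - real i) * \<beta> - c)\<bar> < \<epsilon>}" for i :: nat
  have T [measurable]: "T i \<in> sets lborel" for i
    unfolding T_def by measurable
  have J: "of_int J * \<beta> \<le> c + \<epsilon>"
    using \<beta> of_int_floor_le[of "(c + \<epsilon>) / \<beta>"] unfolding J_def by (simp only: pos_le_divide_eq)
  have "(\<integral>\<^sup>+t. ennreal (exp (G t)) * indicator {t \<in> {0<..<s}. near \<beta> \<epsilon> (G t + c)} t \<partial>lborel)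
    \<le> (\<integral>\<^sup>+t. (\<Sum>i. ennreal (exp 2 * exp (- \<beta>) ^ i) * indicator (T i) t) \<partial>lborel)"
  proof (rule nn_integral_mono)
    fix t :: real
    show "ennreal (exp (G t)) * indicator {t \<in> {0<..<s}. near \<beta> \<epsilon> (G t + c)} t
      \<le> (\<Sum>i. ennreal (exp 2 * exp (- \<beta>) ^ i) * indicator (T i) t)"
    proof (cases "t \<in> {0<..<s} \<and> near \<beta> \<epsilon> (G t + c)")
      case True
      then obtain j where j: "\<bar>G t + c - of_int j * \<beta>\<bar> < \<epsilon>" by (auto simp: near_def)
      have "of_int j * \<beta> \<le> c + \<epsilon>" using j neg[of t] True by auto
      then have "j \<le> J" using \<beta> by (simp add: J_def le_floor_iff field_simps)
      define i where "i = nat (J - j)"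
      have i: "of_int j = of_int J - real i" using \<open>j \<le> J\<close> by (simp add: i_def)
      have tT: "t \<in> T i" using True j by (auto simp: T_def i algebra_simps)
      \<comment> \<open>One \<open>\<epsilon>\<close> comes from the choice of \<open>J\<close>, one
        from the width of the band; both are at most 1.\<close>
      have "G t \<le> 2 - real i * \<beta>" using j J \<epsilon> by (auto simp: i algebra_simps abs_less_iff)
      then have "exp (G t) \<le> exp (2 - real i * \<beta>)" by simp
      also have "\<dots> = exp 2 * exp (- \<beta>) ^ i"
        by (simp add: exp_diff exp_minus exp_of_nat_mult power_inverse divide_inverse)
      finally have "ennreal (exp (G t)) * indicator {t \<in> {0<..<s}. near \<beta> \<epsilon> (G t + c)} t
          \<le> ennreal (exp 2 * exp (- \<beta>) ^ i) * indicator (T i) t"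
        using True tT by (simp add: ennreal_leI)
      also have "\<dots> \<le> (\<Sum>i. ennreal (exp 2 * exp (- \<beta>) ^ i) * indicator (T i) t)"
        by (rule ennreal_term_le_suminf[where h = "\<lambda>i. ennreal (exp 2 * exp (- \<beta>) ^ i) * indicator (T i) t" and i = i])
      finally show ?thesis .
    qed auto
  qed
  also have "\<dots> = (\<Sum>i. ennreal (exp 2 * exp (- \<beta>) ^ i) * emeasure lborel (T i))"
  proof (subst nn_integral_suminf)
    show "(\<lambda>t. ennreal (exp 2 * exp (- \<beta>) ^ i) * indicator (T i) t) \<in> borel_measurable lborel" for i
      by measurable
  qed (simp only: nn_integral_cmult_indicator[OF T])
  also have "\<dots> \<le> (\<Sum>i. ennreal (exp 2 * exp (- \<beta>) ^ i * (4 * sqrt (\<epsilon> / L))))"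
  proof (rule suminf_le)
    fix i
    show "ennreal (exp 2 * exp (- \<beta>) ^ i) * emeasure lborel (T i)
        \<le> ennreal (exp 2 * exp (- \<beta>) ^ i * (4 * sqrt (\<epsilon> / L)))"
      unfolding T_def using emeasure_concave_band[OF conc L \<epsilon>(1)] \<epsilon> L
      by (subst ennreal_mult) (auto intro!: mult_left_mono)
  qed auto
  also have "\<dots> = ennreal (exp 2 * (1 / (1 - exp (- \<beta>))) * (4 * sqrt (\<epsilon> / L)))"
  proof (intro suminf_ennreal_eq)
    show "(\<lambda>i. exp 2 * exp (- \<beta>) ^ i * (4 * sqrt (\<epsilon> / L))) sums (exp 2 * (1 / (1 - exp (- \<beta>))) * (4 * sqrt (\<epsilon> / L)))"
      using \<beta> by (intro sums_mult2 sums_mult geometric_sums) simp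
  qed (use \<epsilon> L in simp)
  also have "exp 2 * (1 / (1 - exp (- \<beta>))) * (4 * sqrt (\<epsilon> / L)) = 4 * exp 2 / (1 - exp (- \<beta>)) * sqrt (\<epsilon> / L)"
    by simp
  finally show ?thesis .
qed

text \<open>On the interval both \<open>t\<close> and \<open>s - t\<close> lie between 0 and 1, so
  each factor of the monomial lowers the second derivative of the logarithm by at least 1.\<close>

lemma concave_log_monomial:
  fixes a b :: nat
  assumes s: "s \<le> 1"
  shows "concave_on {0<..<s} (\<lambda>t. k + real a * ln t + real b * ln (s - t) + real (a + b) / 2 * t\<^sup>2)"
proof (rule f''_le0_imp_concave)
  fix t assume t: "t \<in> {0<..<s}"
  show "((\<lambda>t. k + real a * ln t + real b * ln (s - t) + real (a + b) / 2 * t\<^sup>2) has_real_derivative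
      real a / t - real b / (s - t) + real (a + b) * t) (at t)"
    using t by (auto intro!: derivative_eq_intros simp: divide_simps)
  show "((\<lambda>t. real a / t - real b / (s - t) + real (a + b) * t) has_real_derivative
      real (a + b) - real a / t\<^sup>2 - real b / (s - t)\<^sup>2) (at t)"
    using t by (auto intro!: derivative_eq_intros simp: power2_eq_square)
  have "t\<^sup>2 \<le> 1" "(s - t)\<^sup>2 \<le> 1" using t s by (auto intro!: power_le_one)
  then have "real a \<le> real a / t\<^sup>2" "real b \<le> real b / (s - t)\<^sup>2"
    using t by (auto simp: pos_le_divide_eq intro!: mult_left_le)
  then show "real (a + b) - real a / t\<^sup>2 - real b / (s - t)\<^sup>2 \<le> 0" by simp
qed auto

text \<open>Meant for \<open>N\<close> words sharing one monomial as their probability, with total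
  at most \<open>Q\<close>. Dividing by \<open>Q\<close> makes the logarithm nonpositive, as
  \<open>nn_integral_exp_near_le\<close> requires; the shift \<open>ln (Q / N)\<close> recovers the
  logarithm of the monomial itself.\<close>

lemma nn_integral_monomial_near_le:
  fixes a b :: nat
  assumes s: "s \<le> 1" and ab: "a + b > 0" and \<epsilon>: "0 < \<epsilon>" "\<epsilon> \<le> 1" and \<beta>: "\<beta> > 0"
    and N: "N \<ge> 0" and r: "r > 0" and Q: "Q \<ge> 0"
    and le: "\<And>t. t \<in> {0<..<s} \<Longrightarrow> N * (r * t ^ a * (s - t) ^ b) \<le> Q"
  shows "(\<integral>\<^sup>+t. ennreal (N * (r * t ^ a * (s - t) ^ b))
        * indicator {t \<in> {0<..<s}. near \<beta> \<epsilon> (ln (r * t ^ a * (s - t) ^ b))} t \<partial>lborel)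
    \<le> ennreal (Q * (4 * exp 2 / (1 - exp (- \<beta>)) * sqrt (\<epsilon> / real (a + b))))"
proof (cases "N = 0 \<or> s \<le> 0")
  case True
  have "(\<integral>\<^sup>+t. ennreal (N * (r * t ^ a * (s - t) ^ b))
        * indicator {t \<in> {0<..<s}. near \<beta> \<epsilon> (ln (r * t ^ a * (s - t) ^ b))} t \<partial>lborel) =
      (\<integral>\<^sup>+t. 0 \<partial>(lborel :: real measure))"
    using True by (intro nn_integral_cong) (auto simp: indicator_def)
  then show ?thesis by simp
next
  case False
  with N have N: "N > 0" by simp
  \<comment> \<open>The midpoint of the interval witnesses \<open>Q > 0\<close>, needed for the
    division by \<open>Q\<close>.\<close>
  have "0 < N * (r * (s / 2) ^ a * (s - s / 2) ^ b)" using False N r by simp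
  also have "\<dots> \<le> Q" using False by (intro le) auto
  finally have Q: "Q > 0" .
  define G where "G t = ln (N * r / Q) + real a * ln t + real b * ln (s - t)" for t
  have [measurable]: "G \<in> borel_measurable borel" unfolding G_def by measurable
  have conc: "concave_on {0<..<s} (\<lambda>t. G t + real (a + b) / 2 * t\<^sup>2)"
    unfolding G_def by (rule concave_log_monomial[OF s])
  have expG: "exp (G t) = N * (r * t ^ a * (s - t) ^ b) / Q" if "t \<in> {0<..<s}" for t
    using that N r Q by (simp add: G_def exp_add exp_of_nat_mult)
  have G: "G t + ln (Q / N) = ln (r * t ^ a * (s - t) ^ b)" if "t \<in> {0<..<s}" for t
    using that N r Q by (simp add: G_def ln_mult ln_div ln_realpow)
  have neg: "G t \<le> 0" if "t \<in> {0<..<s}" for t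
  proof -
    have "exp (G t) \<le> 1" unfolding expG[OF that] using le[OF that] Q by simp
    then show ?thesis by simp
  qed
  have "(\<integral>\<^sup>+t. ennreal (N * (r * t ^ a * (s - t) ^ b))
        * indicator {t \<in> {0<..<s}. near \<beta> \<epsilon> (ln (r * t ^ a * (s - t) ^ b))} t \<partial>lborel)
      = (\<integral>\<^sup>+t. ennreal Q * (ennreal (exp (G t)) * indicator {t \<in> {0<..<s}. near \<beta> \<epsilon> (G t + ln (Q / N))} t) \<partial>lborel)"
  proof (rule nn_integral_cong)
    fix t :: real
    have "ennreal (N * (r * t ^ a * (s - t) ^ b)) = ennreal Q * ennreal (exp (G t))" if "t \<in> {0<..<s}"
      unfolding expG[OF that] using Q that N r by (subst ennreal_mult[symmetric]) auto
    then show "ennreal (N * (r * t ^ a * (s - t) ^ b))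
        * indicator {t \<in> {0<..<s}. near \<beta> \<epsilon> (ln (r * t ^ a * (s - t) ^ b))} t =
      ennreal Q * (ennreal (exp (G t)) * indicator {t \<in> {0<..<s}. near \<beta> \<epsilon> (G t + ln (Q / N))} t)"
      using G[of t] by (auto simp: indicator_def simp flip: mult.assoc)
  qed
  also have "\<dots> = ennreal Q * (\<integral>\<^sup>+t. (ennreal (exp (G t)) * indicator {t \<in> {0<..<s}. near \<beta> \<epsilon> (G t + ln (Q / N))} t) \<partial>lborel)"
    unfolding near_def by (intro nn_integral_cmult) measurable
  also have "\<dots> \<le> ennreal Q * ennreal (4 * exp 2 / (1 - exp (- \<beta>)) * sqrt (\<epsilon> / real (a + b)))"
    using ab by (intro mult_left_mono nn_integral_exp_near_le conc \<epsilon> \<beta> neg) auto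
  also have "\<dots> = ennreal (Q * (4 * exp 2 / (1 - exp (- \<beta>)) * sqrt (\<epsilon> / real (a + b))))"
    using Q \<epsilon> \<beta> by (intro ennreal_mult[symmetric]) auto
  finally show ?thesis .
qed

text \<open>A level set lies in bands of every width, and their measure tends to 0.\<close>

lemma AE_monomial_not_near:
  fixes a b :: nat
  assumes s: "s \<le> 1" and ab: "a + b > 0" and r: "(r::real) > 0"
  shows "AE t in lborel. (t::real) \<in> {0<..<s} \<longrightarrow> ln (r * t ^ a * (s - t) ^ b) \<noteq> c"
proof -
  define G where "G t = ln r + real a * ln t + real b * ln (s - t)" for t
  define T where "T = {t \<in> {0<..<s}. G t = c}"
  have [measurable]: "G \<in> borel_measurable borel" unfolding G_def by measurable
  have T: "T \<in> sets lborel" unfolding T_def by measurable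
  have conc: "concave_on {0<..<s} (\<lambda>t. G t + real (a + b) / 2 * t\<^sup>2)"
    unfolding G_def by (rule concave_log_monomial[OF s])
  have "emeasure lborel T \<le> ennreal e" if e: "e > 0" for e
  proof -
    \<comment> \<open>Chosen so that the band estimate
      \<open>4 * sqrt (\<epsilon> / real (a + b))\<close> is exactly \<open>e\<close>.\<close>
    define \<epsilon> where "\<epsilon> = (e / 4)\<^sup>2 * real (a + b)"
    have \<epsilon>: "\<epsilon> > 0" unfolding \<epsilon>_def using e ab by (intro mult_pos_pos) auto
    have "emeasure lborel T \<le> emeasure lborel {t \<in> {0<..<s}. \<bar>G t - c\<bar> < \<epsilon>}"
      using \<epsilon> by (intro emeasure_mono) (auto simp: T_def)
    also have "\<dots> \<le> ennreal (4 * sqrt (\<epsilon> / real (a + b)))"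
      using ab by (intro emeasure_concave_band conc \<epsilon>) auto
    also have "4 * sqrt (\<epsilon> / real (a + b)) = e"
    proof -
      have "real (a + b) \<noteq> 0" using ab by linarith
      then have "\<epsilon> / real (a + b) = (e / 4)\<^sup>2" unfolding \<epsilon>_def by (rule nonzero_mult_div_cancel_right)
      then show ?thesis using e by simp
    qed
    finally show ?thesis .
  qed
  then have "emeasure lborel T \<le> 0" by - (rule ennreal_le_epsilon, simp)
  then have "T \<in> null_sets lborel" using T by (intro null_setsI) auto
  moreover have "G t = ln (r * t ^ a * (s - t) ^ b)" if "t \<in> {0<..<s}" for t
    using that r by (simp add: G_def ln_mult ln_realpow)
  then have "{t \<in> space lborel. \<not> (t \<in> {0<..<s} \<longrightarrow> ln (r * t ^ a * (s - t) ^ b) \<noteq> c)} \<subseteq> T"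
    by (auto simp: T_def)
  ultimately show ?thesis by (rule AE_I')
qed

section \<open>Random words near the lattice\<close>

lemma word_prob_Nil [simp]: "word_prob p [] = 1"
  and word_prob_Cons [simp]: "word_prob p (a # w) = p a * word_prob p w"
  by (simp_all add: word_prob_def)

text \<open>Identifying letters along \<open>e\<close> sends a Bernoulli source to the Bernoulli
  source with the added-up letter probabilities.\<close>

lemma sum_word_prob_fibre:
  fixes p :: "nat \<Rightarrow> real"
  assumes fin: "finite S"
  shows "(\<Sum>w | w \<in> words S (length v) \<and> map e w = v. word_prob p w) =
    word_prob (\<lambda>b. \<Sum>a | a \<in> S \<and> e a = b. p a) v"
proof (induction v)
  case Nil
  have "{w. w \<in> words S (length []) \<and> map e w = []} = {[]}" by (auto simp: words_def)
  then show ?case by simp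
next
  case (Cons b v)
  have *: "(\<Sum>w | w \<in> words S K \<and> map e w = u. word_prob p w)
      = (\<Sum>w\<in>words S K. if map e w = u then word_prob p w else 0)" for u K
    by (rule sum.inter_filter) (rule finite_words[OF fin])
  have "(\<Sum>w | w \<in> words S (length (b # v)) \<and> map e w = b # v. word_prob p w)
      = (\<Sum>a\<in>S. \<Sum>w\<in>words S (length v). if e a = b \<and> map e w = v then p a * word_prob p w else 0)"
    unfolding * by (simp add: sum_words_Suc[OF fin] cong: if_cong)
  also have "\<dots> = (\<Sum>a\<in>S. (if e a = b then p a else 0) *
      (\<Sum>w\<in>words S (length v). if map e w = v then word_prob p w else 0))"
    unfolding sum_distrib_left by (intro sum.cong refl) simp
  also have "\<dots> = (\<Sum>a | a \<in> S \<and> e a = b. p a) * word_prob (\<lambda>b. \<Sum>a | a \<in> S \<and> e a = b. p a) v"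
    unfolding Cons.IH[symmetric] unfolding * sum_distrib_right[symmetric] sum.inter_filter[OF fin] ..
  finally show ?case by simp
qed

text \<open>A line of sources with parameter \<open>t\<close>. The joint probability
  \<open>s\<close> of \<open>\<alpha>\<close> and \<open>\<omega>\<close> is constant on it, so
  whatever sees only the merged letter does not depend on \<open>t\<close>.\<close>

definition split_prob :: "nat \<Rightarrow> nat \<Rightarrow> (nat \<Rightarrow> real) \<Rightarrow> real \<Rightarrow> real \<Rightarrow> nat \<Rightarrow> real" where
  "split_prob \<alpha> \<omega> z s t a = (if a = \<alpha> then t else if a = \<omega> then s - t else z a)"

lemma word_prob_split_prob:
  assumes "\<alpha> \<noteq> \<omega>"
  shows "word_prob (split_prob \<alpha> \<omega> z s t) w =
    word_prob (\<lambda>a. if a = \<alpha> \<or> a = \<omega> then 1 else z a) w * t ^ count_list w \<alpha> * (s - t) ^ count_list w \<omega>"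
  using assms by (induction w) (auto simp: split_prob_def)

lemma sum_split_prob:
  assumes "finite S" "\<alpha> \<in> S" "\<omega> \<in> S" "\<alpha> \<noteq> \<omega>"
  shows "sum (split_prob \<alpha> \<omega> z s t) S = s + sum z (S - {\<alpha>, \<omega>})"
proof -
  have S: "S = insert \<alpha> (insert \<omega> (S - {\<alpha>, \<omega>}))" using assms by auto
  have "sum (split_prob \<alpha> \<omega> z s t) S = s + sum (split_prob \<alpha> \<omega> z s t) (S - {\<alpha>, \<omega>})"
    using assms by (subst S) (simp add: split_prob_def)
  also have "sum (split_prob \<alpha> \<omega> z s t) (S - {\<alpha>, \<omega>}) = sum z (S - {\<alpha>, \<omega>})"
    by (intro sum.cong) (auto simp: split_prob_def)
  finally show ?thesis .
qed

lemma sum_merge_split_prob: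
  assumes "finite S" "\<alpha> \<in> S" "\<omega> \<in> S" "\<alpha> \<noteq> \<omega>"
  shows "(\<Sum>a | a \<in> S \<and> (if a = \<omega> then \<alpha> else a) = b. split_prob \<alpha> \<omega> z s t a) =
     (if b = \<alpha> then s else if b \<in> S - {\<omega>} then z b else 0)"
proof -
  have "{a. a \<in> S \<and> (if a = \<omega> then \<alpha> else a) = b} =
      (if b = \<alpha> then {\<alpha>, \<omega>} else if b \<in> S - {\<omega>} then {b} else {})"
    using assms by (auto split: if_splits)
  then show ?thesis using assms by (auto simp: split_prob_def)
qed

text \<open>The term \<open>(1 - s) ^ K\<close> accounts for the words without the letters \<open>\<alpha>\<close> and \<open>\<omega>\<close>, whose
  probability does not depend on \<open>t\<close>.\<close>

lemma nn_integral_near_word_le: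
  fixes S :: "nat set" and z :: "nat \<Rightarrow> real"
  assumes S: "finite S" "\<alpha> \<in> S" "\<omega> \<in> S" "\<alpha> \<noteq> \<omega>"
    and z: "\<And>a. a \<in> S - {\<alpha>, \<omega>} \<Longrightarrow> z a > 0"
    and s: "s = 1 - sum z (S - {\<alpha>, \<omega>})" "s > 0"
    and \<epsilon>: "0 < \<epsilon>" "\<epsilon> \<le> 1" and \<beta>: "\<beta> > 0"
  shows "(\<Sum>w\<in>words S K. \<integral>\<^sup>+t. ennreal (word_prob (split_prob \<alpha> \<omega> z s t) w) *
      indicator {t \<in> {0<..<s}. near \<beta> \<epsilon> (ln (word_prob (split_prob \<alpha> \<omega> z s t) w))} t \<partial>lborel)
    \<le> ennreal ((1 - s) ^ K + 2 * (4 * exp 2 / (1 - exp (- \<beta>))) * sqrt (real K * \<epsilon>))"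
proof -
  define p where "p = split_prob \<alpha> \<omega> z s"
  \<comment> \<open>\<open>r w\<close> is the factor of the word probability free of
    \<open>t\<close>; \<open>e\<close> below merges \<open>\<omega>\<close> into
    \<open>\<alpha>\<close>.\<close>
  define r where "r = word_prob (\<lambda>a. if a = \<alpha> \<or> a = \<omega> then 1 else z a)"
  define e where "e a = (if a = \<omega> then \<alpha> else a)" for a
  define C where "C = 4 * exp 2 / (1 - exp (- \<beta>))"
  define f where "f w = (\<integral>\<^sup>+t. ennreal (word_prob (p t) w) *
      indicator {t \<in> {0<..<s}. near \<beta> \<epsilon> (ln (word_prob (p t) w))} t \<partial>lborel)" for w
  have C: "C \<ge> 0" using \<beta> by (simp add: C_def)
  have s1: "s \<le> 1" using sum_nonneg[of "S - {\<alpha>, \<omega>}" z] z by (simp add: s less_imp_le)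
  have pr: "word_prob (p t) w = r w * t ^ count_list w \<alpha> * (s - t) ^ count_list w \<omega>" for t w
    unfolding p_def r_def by (rule word_prob_split_prob[OF S(4)])
  have rpos: "r w > 0" if "w \<in> words S K" for w
    unfolding r_def using that z by (intro word_prob_pos) (auto simp: words_def)
  have rmap: "r (map e w) = r w" for w
    unfolding r_def by (induction w) (auto simp: e_def)
  have cmap: "count_list (map e w) \<alpha> = count_list w \<alpha> + count_list w \<omega>" for w
    using S(4) by (induction w) (auto simp: e_def)
  have fin: "finite (words S K)" by (rule finite_words[OF S(1)])
  define A where "A = {w \<in> words S K. count_list w \<alpha> + count_list w \<omega> = 0}"
  define B where "B = {w \<in> words S K. count_list w \<alpha> + count_list w \<omega> > 0}"
  have AB: "words S K = A \<union> B" "A \<inter> B = {}" "finite A" "finite B"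
    using fin by (auto simp: A_def B_def)

  have "(\<Sum>w\<in>A. f w) \<le> (\<Sum>w\<in>A. ennreal (r w))"
  proof (rule sum_mono)
    fix w assume w: "w \<in> A"
    have "f w \<le> (\<integral>\<^sup>+t. ennreal (r w) * indicator {0<..<s} t \<partial>lborel)"
      unfolding f_def pr using w by (intro nn_integral_mono) (auto simp: A_def indicator_def)
    also have "\<dots> = ennreal (r w) * ennreal s"
      using s by (simp add: nn_integral_cmult_indicator)
    also have "\<dots> \<le> ennreal (r w)"
      using s1 s(2) rpos[of w] w by (auto simp: A_def simp flip: ennreal_mult intro!: ennreal_leI mult_left_le)
    finally show "f w \<le> ennreal (r w)" .
  qed
  also have "\<dots> = ennreal (\<Sum>w\<in>A. r w)"
    using rpos by (intro sum_ennreal) (auto simp: A_def less_imp_le)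
  also have "(\<Sum>w\<in>A. r w) = (1 - s) ^ K"
  proof -
    have "A = words (S - {\<alpha>, \<omega>}) K"
      by (auto simp: A_def words_def count_list_0_iff)
    moreover have "r w = prod_list (map z w)" if "w \<in> words (S - {\<alpha>, \<omega>}) K" for w
      using that unfolding r_def word_prob_def words_def
      by (intro arg_cong[of _ _ prod_list] map_cong refl) auto
    ultimately have "(\<Sum>w\<in>A. r w) = sum z (S - {\<alpha>, \<omega>}) ^ K"
      using S(1) by (simp add: sum_prod_list_words)
    then show ?thesis by (simp add: s)
  qed
  finally have sumA: "(\<Sum>w\<in>A. f w) \<le> ennreal ((1 - s) ^ K)" .

  \<comment> \<open>The probability of the merged word \<open>v\<close>. It does not depend on
    \<open>t\<close>, so the value \<open>s / 2\<close> is an arbitrary choice.\<close>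
  define Q where "Q v = (\<Sum>w | w \<in> words S K \<and> map e w = v. word_prob (p (s / 2)) w)" for v
  have Q: "(\<Sum>w | w \<in> words S K \<and> map e w = v. word_prob (p t) w) = Q v" for v t
  proof (cases "length v = K")
    case True
    then show ?thesis unfolding Q_def p_def e_def
      using sum_word_prob_fibre[OF S(1), where v = v and e = "\<lambda>a. if a = \<omega> then \<alpha> else a"]
        sum_merge_split_prob[OF S] by simp
  next
    case False
    then have "{w. w \<in> words S K \<and> map e w = v} = {}" by (auto simp: words_def)
    then show ?thesis unfolding Q_def by (simp only: sum.empty)
  qed
  have wpos: "word_prob (p t) w \<ge> 0" if "w \<in> words S K" "t \<in> {0<..<s}" for t w
    unfolding pr using rpos[OF that(1)] that(2) by simp
  have Qpos: "Q v \<ge> 0" for v unfolding Q_def using s by (intro sum_nonneg wpos) auto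
  have Q1: "(\<Sum>v\<in>map e ` words S K. Q v) = 1"
  proof -
    have "(\<Sum>v\<in>map e ` words S K. Q v) = (\<Sum>w\<in>words S K. word_prob (p (s / 2)) w)"
      unfolding Q_def by (rule sum.image_gen[OF fin, symmetric])
    also have "\<dots> = 1"
      unfolding word_prob_def sum_prod_list_words[OF S(1)] p_def sum_split_prob[OF S] by (simp add: s)
    finally show ?thesis .
  qed

  \<comment> \<open>The merged word and the number of \<open>\<omega>\<close> fix the number of
    \<open>\<alpha>\<close> too, so all words of one class have the same monomial in
    \<open>t\<close> as their probability.\<close>
  define g where "g w = (map e w, count_list w \<omega>)" for w
  define L where "L v = count_list v \<alpha>" for v
  have class_le: "(\<Sum>w | w \<in> B \<and> g w = (v, k). f w) \<le> ennreal (Q v * (C * sqrt (\<epsilon> / real (L v))))"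
    if vk: "(v, k) \<in> g ` B" for v k
  proof -
    let ?c = "{w. w \<in> B \<and> g w = (v, k)}"
    obtain w0 where w0: "w0 \<in> B" "map e w0 = v" "count_list w0 \<omega> = k" using vk by (auto simp: g_def)
    have k: "k \<le> L v" using cmap[of w0] w0 by (simp add: L_def)
    have rv: "r v > 0" using rpos[of w0] rmap[of w0] w0 by (simp add: B_def)
    have prc: "word_prob (p t) w = r v * t ^ (L v - k) * (s - t) ^ k" if "w \<in> ?c" for t w
      using that rmap[of w] cmap[of w] unfolding pr by (auto simp: g_def L_def)
    have Lv: "L v - k + k > 0" using cmap[of w0] w0 k by (simp add: L_def B_def)
    have "(\<Sum>w\<in>?c. f w) = (\<Sum>w\<in>?c. \<integral>\<^sup>+t. ennreal (r v * t ^ (L v - k) * (s - t) ^ k) *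
      indicator {t \<in> {0<..<s}. near \<beta> \<epsilon> (ln (r v * t ^ (L v - k) * (s - t) ^ k))} t \<partial>lborel)"
      unfolding f_def by (intro sum.cong refl) (simp only: prc)
    also have "\<dots> = (\<integral>\<^sup>+t. ennreal (real (card ?c)) * (ennreal (r v * t ^ (L v - k) * (s - t) ^ k) *
      indicator {t \<in> {0<..<s}. near \<beta> \<epsilon> (ln (r v * t ^ (L v - k) * (s - t) ^ k))} t) \<partial>lborel)"
      unfolding near_def by (subst nn_integral_cmult) (auto simp: ennreal_of_nat_eq_real_of_nat)
    also have "\<dots> = (\<integral>\<^sup>+t. ennreal (real (card ?c) * (r v * t ^ (L v - k) * (s - t) ^ k)) *
      indicator {t \<in> {0<..<s}. near \<beta> \<epsilon> (ln (r v * t ^ (L v - k) * (s - t) ^ k))} t \<partial>lborel)"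
      using rv by (intro nn_integral_cong) (auto simp: indicator_def ennreal_mult)
    \<comment> \<open>The multiplicity is the class size. The class is part of the fibre over
      \<open>v\<close>, so its total probability is at most \<open>Q v\<close> for every
      \<open>t\<close>.\<close>
    also have "\<dots> \<le> ennreal (Q v * (4 * exp 2 / (1 - exp (- \<beta>)) * sqrt (\<epsilon> / real (L v - k + k))))"
    proof (rule nn_integral_monomial_near_le[OF s1 Lv \<epsilon> \<beta> _ rv Qpos])
      fix t assume t: "t \<in> {0<..<s}"
      have "real (card ?c) * (r v * t ^ (L v - k) * (s - t) ^ k) = (\<Sum>w\<in>?c. word_prob (p t) w)"
        by (simp add: prc)
      also have "\<dots> \<le> (\<Sum>w | w \<in> words S K \<and> map e w = v. word_prob (p t) w)"
        using fin t by (intro sum_mono2 wpos) (auto simp: B_def g_def)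
      finally show "real (card ?c) * (r v * t ^ (L v - k) * (s - t) ^ k) \<le> Q v" unfolding Q .
    qed simp
    finally show ?thesis using k by (simp add: C_def)
  qed
  have "(\<Sum>w\<in>B. f w) = (\<Sum>y\<in>g ` B. \<Sum>w | w \<in> B \<and> g w = y. f w)"
    by (rule sum.image_gen[OF AB(4)])
  also have "\<dots> \<le> (\<Sum>y\<in>g ` B. ennreal (Q (fst y) * (C * sqrt (\<epsilon> / real (L (fst y))))))"
  proof (rule sum_mono)
    fix y assume "y \<in> g ` B"
    then show "(\<Sum>w | w \<in> B \<and> g w = y. f w) \<le> ennreal (Q (fst y) * (C * sqrt (\<epsilon> / real (L (fst y)))))"
      using class_le[of "fst y" "snd y"] by simp
  qed
  \<comment> \<open>Each \<open>v\<close> has at most \<open>L v + 1\<close> classes. Since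
    \<open>L v \<ge> 1\<close>, their bounds add up to order
    \<open>sqrt (real (L v) * \<epsilon>)\<close>, and \<open>L v \<le> K\<close>.\<close>
  also have "\<dots> \<le> (\<Sum>y\<in>(SIGMA v:map e ` B. {..L v}). ennreal (Q (fst y) * (C * sqrt (\<epsilon> / real (L (fst y))))))"
    using AB(4) by (intro sum_mono2) (auto simp: g_def L_def cmap)
  also have "\<dots> = (\<Sum>v\<in>map e ` B. \<Sum>k\<le>L v. ennreal (Q v * (C * sqrt (\<epsilon> / real (L v)))))"
    using AB(4) by (subst sum.Sigma) (auto simp: case_prod_unfold)
  also have "\<dots> = (\<Sum>v\<in>map e ` B. ennreal (\<Sum>k\<le>L v. Q v * (C * sqrt (\<epsilon> / real (L v)))))"
    using Qpos C \<epsilon> by (intro sum.cong refl sum_ennreal) auto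
  also have "\<dots> \<le> (\<Sum>v\<in>map e ` B. ennreal (Q v * (2 * C * sqrt (real K * \<epsilon>))))"
  proof (intro sum_mono ennreal_leI)
    fix v assume "v \<in> map e ` B"
    then obtain w where w: "w \<in> B" "v = map e w" by auto
    have L: "L v > 0" using w cmap[of w] by (simp add: B_def L_def)
    have "L v \<le> length v" unfolding L_def by (rule count_le_length)
    then have LK: "L v \<le> K" using w by (simp add: B_def words_def)
    have "(\<Sum>k\<le>L v. Q v * (C * sqrt (\<epsilon> / real (L v)))) = Q v * C * ((real (L v) + 1) * sqrt (\<epsilon> / real (L v)))"
      by (simp add: algebra_simps)
    also have "\<dots> \<le> Q v * C * (2 * sqrt (real K * \<epsilon>))"
    proof (intro mult_left_mono mult_nonneg_nonneg Qpos C)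
      have "(real (L v) + 1) * sqrt (\<epsilon> / real (L v)) \<le> (2 * real (L v)) * sqrt (\<epsilon> / real (L v))"
        using L \<epsilon> by (intro mult_right_mono) auto
      also have "\<dots> = 2 * sqrt (real (L v) * \<epsilon>)"
      proof -
        have "real (L v) * \<epsilon> = (real (L v))\<^sup>2 * (\<epsilon> / real (L v))" using L by (simp add: power2_eq_square)
        then have "sqrt (real (L v) * \<epsilon>) = real (L v) * sqrt (\<epsilon> / real (L v))" by (simp only: real_sqrt_mult real_sqrt_abs abs_of_nat)
        then show ?thesis by simp
      qed
      also have "\<dots> \<le> 2 * sqrt (real K * \<epsilon>)" using LK \<epsilon> by simp
      finally show "(real (L v) + 1) * sqrt (\<epsilon> / real (L v)) \<le> 2 * sqrt (real K * \<epsilon>)" .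
    qed
    finally show "(\<Sum>k\<le>L v. Q v * (C * sqrt (\<epsilon> / real (L v)))) \<le> Q v * (2 * C * sqrt (real K * \<epsilon>))"
      by (simp add: algebra_simps)
  qed
  also have "\<dots> = ennreal (\<Sum>v\<in>map e ` B. Q v * (2 * C * sqrt (real K * \<epsilon>)))"
    using Qpos C \<epsilon> by (intro sum_ennreal) auto
  also have "\<dots> = ennreal ((\<Sum>v\<in>map e ` B. Q v) * (2 * C * sqrt (real K * \<epsilon>)))"
    by (simp add: sum_distrib_right)
  also have "\<dots> \<le> ennreal ((\<Sum>v\<in>map e ` words S K. Q v) * (2 * C * sqrt (real K * \<epsilon>)))"
    using fin C \<epsilon> Qpos by (intro ennreal_leI mult_right_mono sum_mono2) (auto simp: B_def)
  finally have sumB: "(\<Sum>w\<in>B. f w) \<le> ennreal (2 * C * sqrt (real K * \<epsilon>))" by (simp add: Q1)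
  have "(\<Sum>w\<in>words S K. f w) = (\<Sum>w\<in>A. f w) + (\<Sum>w\<in>B. f w)"
    using AB by (simp add: sum.union_disjoint)
  also have "\<dots> \<le> ennreal ((1 - s) ^ K) + ennreal (2 * C * sqrt (real K * \<epsilon>))"
    by (intro add_mono sumA sumB)
  also have "\<dots> = ennreal ((1 - s) ^ K + 2 * C * sqrt (real K * \<epsilon>))"
    using s1 C \<epsilon> by (intro ennreal_plus[symmetric]) auto
  finally show ?thesis unfolding f_def p_def C_def .
qed

section \<open>Almost every source\<close>

text \<open>Tonelli in the coordinate \<open>i\<close>: a measurable exceptional set all of whose
  slices are null is null.\<close>

lemma AE_PiM_lborel_slice:
  fixes P :: "('i \<Rightarrow> real) \<Rightarrow> bool"
  assumes I: "finite I" "i \<in> I"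
    and meas: "{x \<in> space (Pi\<^sub>M I (\<lambda>_. lborel)). P x} \<in> sets (Pi\<^sub>M I (\<lambda>_. lborel))"
    and slice: "\<And>x. AE y in lborel. P (x(i := y))"
  shows "AE x in Pi\<^sub>M I (\<lambda>_. lborel). P x"
proof -
  interpret product_sigma_finite "\<lambda>_ :: 'i. lborel :: real measure" by standard
  have I': "I = insert i (I - {i})" "finite (I - {i})" "i \<notin> I - {i}" using I by auto
  let ?M = "Pi\<^sub>M I (\<lambda>_. lborel :: real measure)"
  let ?N = "{x \<in> space ?M. \<not> P x}"
  have N: "?N \<in> sets ?M" using meas by (rule sets.sets_Collect_neg)
  have "emeasure ?M ?N = (\<integral>\<^sup>+x. indicator ?N x \<partial>?M)" using N by simp
  also have "\<dots> = (\<integral>\<^sup>+x. (\<integral>\<^sup>+y. indicator ?N (x(i := y)) \<partial>lborel) \<partial>Pi\<^sub>M (I - {i}) (\<lambda>_. lborel))"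
    by (subst I'(1), rule product_nn_integral_insert[OF I'(2,3)])
       (use N I'(1) in \<open>simp add: insert_absorb[OF I(2)]\<close>)
  also have "\<dots> = (\<integral>\<^sup>+x. 0 \<partial>Pi\<^sub>M (I - {i}) (\<lambda>_. lborel :: real measure))"
  proof (rule nn_integral_cong)
    fix x :: "'i \<Rightarrow> real"
    have "(\<integral>\<^sup>+y. indicator ?N (x(i := y)) \<partial>lborel) = (\<integral>\<^sup>+y. 0 \<partial>(lborel :: real measure))"
      using slice[of x] by (intro nn_integral_cong_AE) (auto elim!: eventually_mono simp: indicator_def)
    then show "(\<integral>\<^sup>+y. indicator ?N (x(i := y)) \<partial>lborel) = 0" by simp
  qed
  finally have "?N \<in> null_sets ?M" using N by (auto intro: null_setsI)
  then show ?thesis by (rule AE_I') auto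
qed

section \<open>Measurability in the source parameters\<close>

lemma borel_measurable_coordinate:
  "j \<in> I \<Longrightarrow> (\<lambda>x. x j) \<in> borel_measurable (Pi\<^sub>M I (\<lambda>_. lborel :: real measure))"
  using measurable_component_singleton[of j I "\<lambda>_. lborel :: real measure"] by simp

lemma borel_measurable_word_prob_source [measurable]:
  assumes "set w \<subseteq> {1..m}"
  shows "(\<lambda>x. word_prob (source_prob m x) w) \<in> borel_measurable (Pi\<^sub>M {1..<m} (\<lambda>_. lborel))"
  using assms
proof (induction w)
  case (Cons a w)
  note comp = borel_measurable_coordinate
  have "(\<lambda>x. source_prob m x a) \<in> borel_measurable (Pi\<^sub>M {1..<m} (\<lambda>_. lborel))"
  proof (cases "a = m")
    case True
    then show ?thesis unfolding source_prob_def using comp by (auto intro!: borel_measurable_diff borel_measurable_sum)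
  next
    case False
    then show ?thesis unfolding source_prob_def using comp[of a "{1..<m}"] Cons.prems by simp
  qed
  then show ?case using Cons by simp
qed simp

text \<open>For \<open>K = 0\<close> the tolerance is \<open>1 / 0 = 0\<close>, and \<^term>\<open>near \<beta> 0\<close> is always false.\<close>

definition near_mass :: "nat \<Rightarrow> real \<Rightarrow> (nat \<Rightarrow> real) \<Rightarrow> nat \<Rightarrow> real" where
  "near_mass m \<beta> p K = (\<Sum>w\<in>words {1..m} K.
     word_prob p w * of_bool (near \<beta> (1 / real K ^ 4) (ln (word_prob p w))))"

lemma word_prob_cong: "(\<And>a. a \<in> set w \<Longrightarrow> p a = q a) \<Longrightarrow> word_prob p w = word_prob q w"
  unfolding word_prob_def by (simp cong: map_cong)

lemma near_mass_cong: "(\<And>a. a \<in> {1..m} \<Longrightarrow> p a = q a) \<Longrightarrow> near_mass m \<beta> p K = near_mass m \<beta> q K"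
  unfolding near_mass_def using word_prob_cong[of _ p q]
  by (intro sum.cong refl) (auto simp: words_def subset_iff)

definition source_domain :: "nat \<Rightarrow> (nat \<Rightarrow> real) \<Rightarrow> bool" where
  "source_domain m x \<longleftrightarrow> (\<forall>i\<in>{1..<m}. 0 < x i) \<and> (\<Sum>i\<in>{1..<m}. x i) < 1"

lemma sets_source_domain:
  "{x \<in> space (Pi\<^sub>M {1..<m} (\<lambda>_. lborel)). source_domain m x} \<in> sets (Pi\<^sub>M {1..<m} (\<lambda>_. lborel))"
proof -
  let ?M = "Pi\<^sub>M {1..<m} (\<lambda>_. lborel :: real measure)"
  have "{x \<in> space ?M. 0 < x i} \<in> sets ?M" if "i \<in> {1..<m}" for i
    using that by (intro borel_measurable_less borel_measurable_const borel_measurable_coordinate)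
  then have "{x \<in> space ?M. \<forall>i\<in>{1..<m}. 0 < x i} \<in> sets ?M"
    by (intro sets.sets_Collect_finite_All) auto
  moreover have "{x \<in> space ?M. (\<Sum>i\<in>{1..<m}. x i) < 1} \<in> sets ?M"
    by (intro borel_measurable_less borel_measurable_const borel_measurable_sum borel_measurable_coordinate)
  ultimately show ?thesis
    unfolding source_domain_def by (intro sets.sets_Collect_conj)
qed

text \<open>Changing one free coordinate also changes the last probability, by the opposite amount,
  so slices are lines of the form \<open>split_prob\<close>.\<close>

lemma source_prob_slice:
  assumes i: "i \<in> {1..<m}" and a: "a \<in> {1..m}"
  shows "source_prob m (x(i := y)) a = split_prob i m x (1 - sum x ({1..m} - {i, m})) y a"
proof -
  have eq: "{1..m} - {i, m} = {1..<m} - {i}" by auto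
  have "(\<Sum>j\<in>{1..<m}. (x(i := y)) j) = y + sum x ({1..<m} - {i})"
    using i by (subst sum.remove[of _ i]) auto
  then show ?thesis using i unfolding eq by (auto simp: source_prob_def split_prob_def)
qed

lemma source_domain_slice:
  assumes i: "i \<in> {1..<m}"
  shows "source_domain m (x(i := y)) \<longleftrightarrow>
    (\<forall>a\<in>{1..m} - {i, m}. 0 < x a) \<and> y \<in> {0<..<1 - sum x ({1..m} - {i, m})}"
proof -
  have eq: "{1..m} - {i, m} = {1..<m} - {i}" by auto
  have "(\<Sum>j\<in>{1..<m}. (x(i := y)) j) = y + sum x ({1..<m} - {i})"
    using i by (subst sum.remove[of _ i]) auto
  then show ?thesis using i unfolding eq by (auto simp: source_domain_def)
qed

text \<open>The reason for the tolerance \<open>1 / real K ^ 4\<close>: the terms are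
  \<open>K\<close> to the power -3/2, whereas a third power would give the harmonic series.\<close>

lemma summable_rate: "summable (\<lambda>K. sqrt (real K * (1 / real K ^ 4)))"
proof -
  have "sqrt (real K * (1 / real K ^ 4)) = real K powr (- 3 / 2)" for K
  proof (cases "K = 0")
    case False
    have "real K * (1 / real K ^ 4) = real K powr (- 3)"
      using False by (simp add: powr_minus powr_numeral eval_nat_numeral divide_inverse)
    then show ?thesis using False by (simp add: powr_half_sqrt[symmetric] powr_powr)
  qed simp
  then show ?thesis by (simp add: summable_real_powr_iff)
qed

text \<open>By Tonelli the integral over \<open>t\<close> of the sum over \<open>K\<close> is at
  most a geometric series plus a multiple of the series in \<open>summable_rate\<close>. It is
  finite, hence so is the integrand almost everywhere.\<close>

lemma AE_summable_near_mass_split: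
  fixes z :: "nat \<Rightarrow> real"
  assumes i: "i \<in> {1..<m}" and \<beta>: "\<beta> > 0"
    and z: "\<And>a. a \<in> {1..m} - {i, m} \<Longrightarrow> z a > 0"
    and s: "s = 1 - sum z ({1..m} - {i, m})" "s > 0"
  shows "AE t in lborel. t \<in> {0<..<s} \<longrightarrow> summable (near_mass m \<beta> (split_prob i m z s t))"
proof -
  define C where "C = 2 * (4 * exp 2 / (1 - exp (- \<beta>)))"
  define f where "f K w t = ennreal (word_prob (split_prob i m z s t) w) *
      indicator {t \<in> {0<..<s}. near \<beta> (1 / real K ^ 4) (ln (word_prob (split_prob i m z s t) w))} t" for K w t
  have C: "C \<ge> 0" using \<beta> by (simp add: C_def)
  have im: "i \<noteq> m" "i \<in> {1..m}" "m \<in> {1..m}" using i by auto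
  have s1: "s \<le> 1" using sum_nonneg[of "{1..m} - {i, m}" z] z by (simp add: s less_imp_le)
  have f[measurable]: "f K w \<in> borel_measurable lborel" for K w
    unfolding f_def word_prob_split_prob[OF im(1)] near_def by measurable
  have bound: "(\<Sum>w\<in>words {1..m} K. \<integral>\<^sup>+t. f K w t \<partial>lborel)
      \<le> ennreal ((1 - s) ^ K + C * sqrt (real K * (1 / real K ^ 4)))" for K
  proof (cases "K = 0")
    case True
    then have "f K w t = 0" for w t by (simp add: f_def near_def)
    then show ?thesis by simp
  next
    case False
    have "1 / real K ^ 4 \<le> 1" using False by simp
    then show ?thesis
      unfolding f_def C_def using False
      by (intro nn_integral_near_word_le im z s \<beta>) auto
  qed
  have "(\<integral>\<^sup>+t. (\<Sum>K. \<Sum>w\<in>words {1..m} K. f K w t) \<partial>lborel)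
      = (\<Sum>K. \<Sum>w\<in>words {1..m} K. \<integral>\<^sup>+t. f K w t \<partial>lborel)"
    by (simp add: nn_integral_suminf nn_integral_sum)
  also have "\<dots> \<le> (\<Sum>K. ennreal ((1 - s) ^ K + C * sqrt (real K * (1 / real K ^ 4))))"
    by (intro suminf_le bound) auto
  also have "\<dots> = ennreal (\<Sum>K. (1 - s) ^ K + C * sqrt (real K * (1 / real K ^ 4)))"
    using s s1 C by (intro suminf_ennreal2 summable_add summable_mult summable_rate summable_geometric) auto
  also have "\<dots> < \<infinity>" by simp
  finally have "AE t in lborel. (\<Sum>K. \<Sum>w\<in>words {1..m} K. f K w t) \<noteq> \<infinity>"
    by (intro nn_integral_PInf_AE) auto
  then show ?thesis
  proof eventually_elim
    fix t assume fin: "(\<Sum>K. \<Sum>w\<in>words {1..m} K. f K w t) \<noteq> \<infinity>"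
    show "t \<in> {0<..<s} \<longrightarrow> summable (near_mass m \<beta> (split_prob i m z s t))"
    proof
      assume t: "t \<in> {0<..<s}"
      have pos: "word_prob (split_prob i m z s t) w \<ge> 0" if "w \<in> words {1..m} K" for w K
        using that t z im unfolding words_def
        by (intro less_imp_le word_prob_pos) (auto simp: split_prob_def subset_iff)
      have "(\<Sum>w\<in>words {1..m} K. f K w t) = ennreal (near_mass m \<beta> (split_prob i m z s t) K)" for K
      proof -
        have "(\<Sum>w\<in>words {1..m} K. f K w t) = (\<Sum>w\<in>words {1..m} K. ennreal (word_prob (split_prob i m z s t) w
            * of_bool (near \<beta> (1 / real K ^ 4) (ln (word_prob (split_prob i m z s t) w)))))"
          using t by (intro sum.cong refl) (auto simp: f_def indicator_def)
        also have "\<dots> = ennreal (near_mass m \<beta> (split_prob i m z s t) K)"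
          unfolding near_mass_def using pos by (intro sum_ennreal) auto
        finally show ?thesis .
      qed
      moreover have "near_mass m \<beta> (split_prob i m z s t) K \<ge> 0" for K
        unfolding near_mass_def using pos by (intro sum_nonneg) auto
      ultimately show "summable (near_mass m \<beta> (split_prob i m z s t))"
        using fin by (intro summable_suminf_not_top) auto
    qed
  qed
qed

text \<open>Slices along the coordinate 1, which exists because \<open>m \<ge> 2\<close>. Where the
  other coordinates admit no source, the claim on the slice is vacuous.\<close>

lemma AE_summable_near_mass:
  assumes m: "m \<ge> 2" and \<beta>: "\<beta> > 0"
  shows "AE x in Pi\<^sub>M {1..<m} (\<lambda>_. lborel). source_domain m x \<longrightarrow> summable (near_mass m \<beta> (source_prob m x))"
proof (rule AE_PiM_lborel_slice)
  show "(1::nat) \<in> {1..<m}" using m by simp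
  have near[measurable]: "Measurable.pred borel (near \<beta> \<epsilon>)" for \<epsilon> unfolding near_def by measurable
  have "(\<lambda>x. near_mass m \<beta> (source_prob m x) K) \<in> borel_measurable (Pi\<^sub>M {1..<m} (\<lambda>_. lborel))" for K
    unfolding near_mass_def of_bool_def
  proof (rule borel_measurable_sum)
    fix w assume "w \<in> words {1..m} K"
    then have [measurable]: "(\<lambda>x. word_prob (source_prob m x) w) \<in> borel_measurable (Pi\<^sub>M {1..<m} (\<lambda>_. lborel))"
      by (intro borel_measurable_word_prob_source) (auto simp: words_def)
    show "(\<lambda>x. word_prob (source_prob m x) w * (if near \<beta> (1 / real K ^ 4) (ln (word_prob (source_prob m x) w)) then 1 else 0))
        \<in> borel_measurable (Pi\<^sub>M {1..<m} (\<lambda>_. lborel))"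
      by measurable
  qed
  then have [measurable]: "(\<lambda>x. near_mass m \<beta> (source_prob m x) K) \<in> borel_measurable (Pi\<^sub>M {1..<m} (\<lambda>_. lborel))" for K .
  \<comment> \<open>Summability is rewritten as the Cauchy property of the partial sums, which
    yields a measurable set.\<close>
  have "{x \<in> space (Pi\<^sub>M {1..<m} (\<lambda>_. lborel)). summable (near_mass m \<beta> (source_prob m x))} \<in> sets (Pi\<^sub>M {1..<m} (\<lambda>_. lborel))"
    unfolding summable_iff_convergent Cauchy_convergent_iff[symmetric]
    by (intro sets_Collect_Cauchy) measurable
  then show "{x \<in> space (Pi\<^sub>M {1..<m} (\<lambda>_. lborel)). source_domain m x \<longrightarrow> summable (near_mass m \<beta> (source_prob m x))}
      \<in> sets (Pi\<^sub>M {1..<m} (\<lambda>_. lborel))"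
    by (intro sets.sets_Collect_imp sets_source_domain)
  fix x :: "nat \<Rightarrow> real"
  let ?s = "1 - sum x ({1..m} - {1, m})"
  have i: "1 \<in> {1..<m}" using m by simp
  show "AE y in lborel. source_domain m (x(1 := y)) \<longrightarrow> summable (near_mass m \<beta> (source_prob m (x(1 := y))))"
  proof (cases "(\<forall>a\<in>{1..m} - {1, m}. 0 < x a) \<and> ?s > 0")
    case True
    have "near_mass m \<beta> (source_prob m (x(1 := y))) = near_mass m \<beta> (split_prob 1 m x ?s y)" for y
      using source_prob_slice[OF i] by (intro ext near_mass_cong) auto
    moreover have "AE t in lborel. t \<in> {0<..<?s} \<longrightarrow> summable (near_mass m \<beta> (split_prob 1 m x ?s t))"
      using True by (intro AE_summable_near_mass_split[OF i \<beta>]) auto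
    ultimately show ?thesis
      using True unfolding source_domain_slice[OF i] by (auto elim!: eventually_mono)
  next
    case False
    then have "\<not> source_domain m (x(1 := y))" for y
      unfolding source_domain_slice[OF i] by auto
    then show ?thesis by simp
  qed
qed simp

lemma AE_ln_word_prob_neq:
  assumes m: "m \<ge> 2" and w: "set w \<subseteq> {1..m}" "w \<noteq> []"
  shows "AE x in Pi\<^sub>M {1..<m} (\<lambda>_. lborel). source_domain m x \<longrightarrow> ln (word_prob (source_prob m x) w) \<noteq> c"
proof -
  \<comment> \<open>The varied coordinate must affect the probability of \<open>w\<close>. If
    \<open>w\<close> starts with the last letter, coordinate 1 serves, because the last probability
    moves with it.\<close>
  define i where "i = (if hd w = m then 1 else hd w)"
  have hd: "hd w \<in> set w" using w by simp
  have i: "i \<in> {1..<m}" using w(1) hd m by (auto simp: i_def dest!: subsetD)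
  have im: "i \<noteq> m" using i by simp
  have "count_list w i + count_list w m > 0"
    using hd by (auto simp: i_def count_list_0_iff intro!: gr0I split: if_splits)
  note cnt = this
  show ?thesis
  proof (rule AE_PiM_lborel_slice)
    have [measurable]: "(\<lambda>x. word_prob (source_prob m x) w) \<in> borel_measurable (Pi\<^sub>M {1..<m} (\<lambda>_. lborel))"
      by (rule borel_measurable_word_prob_source[OF w(1)])
    have "{x \<in> space (Pi\<^sub>M {1..<m} (\<lambda>_. lborel)). ln (word_prob (source_prob m x) w) \<noteq> c} \<in> sets (Pi\<^sub>M {1..<m} (\<lambda>_. lborel))"
      by measurable
    then show "{x \<in> space (Pi\<^sub>M {1..<m} (\<lambda>_. lborel)). source_domain m x \<longrightarrow> ln (word_prob (source_prob m x) w) \<noteq> c}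
        \<in> sets (Pi\<^sub>M {1..<m} (\<lambda>_. lborel))"
      by (intro sets.sets_Collect_imp sets_source_domain)
    fix x :: "nat \<Rightarrow> real"
    let ?s = "1 - sum x ({1..m} - {i, m})"
    show "AE y in lborel. source_domain m (x(i := y)) \<longrightarrow> ln (word_prob (source_prob m (x(i := y))) w) \<noteq> c"
    proof (cases "\<forall>a\<in>{1..m} - {i, m}. 0 < x a")
      case True
      let ?r = "word_prob (\<lambda>a. if a = i \<or> a = m then 1 else x a) w"
      have "?s \<le> 1" using sum_nonneg[of "{1..m} - {i, m}" x] True by (simp add: less_imp_le)
      moreover have "?r > 0" using True w by (intro word_prob_pos) auto
      moreover have "word_prob (source_prob m (x(i := y))) w = ?r * y ^ count_list w i * (?s - y) ^ count_list w m" for y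
        unfolding word_prob_split_prob[OF im, symmetric]
        using source_prob_slice[OF i] w by (intro word_prob_cong) auto
      ultimately show ?thesis
        using AE_monomial_not_near[OF _ cnt, of ?s ?r c]
        unfolding source_domain_slice[OF i] by (auto elim!: eventually_mono)
    next
      case False
      then have "\<not> source_domain m (x(i := y))" for y
        unfolding source_domain_slice[OF i] by blast
      then show ?thesis by simp
    qed
  qed (use i in auto)
qed

section \<open>From lattice distances to the bound for one source\<close>

lemma near_mono: "near \<beta> \<delta> y \<Longrightarrow> \<delta> \<le> \<epsilon> \<Longrightarrow> near \<beta> \<epsilon> y"
  unfolding near_def by (meson less_le_trans)

text \<open>The integers are closed, so \<open>y / \<beta>\<close> has a positive distance from
  them; scaling by \<open>\<beta>\<close> gives \<open>\<delta>\<close>.\<close>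

lemma exists_not_near:
  assumes "\<beta> > 0" "\<And>j::int. y \<noteq> of_int j * \<beta>"
  shows "\<exists>\<delta>>0. \<not> near \<beta> \<delta> y"
proof -
  have "y / \<beta> \<notin> \<int>" using assms by (force elim!: Ints_cases simp: field_simps)
  then have "open (- \<int> :: real set)" "y / \<beta> \<in> - \<int>" by (auto simp: closed_Ints open_Compl)
  then obtain e where e: "e > 0" "\<And>u. dist u (y / \<beta>) < e \<Longrightarrow> u \<notin> \<int>"
    unfolding open_dist by blast
  have "\<not> near \<beta> (e * \<beta>) y"
  proof
    assume "near \<beta> (e * \<beta>) y"
    then obtain j :: int where j: "\<bar>y - of_int j * \<beta>\<bar> < e * \<beta>" by (auto simp: near_def)
    have "\<bar>of_int j - y / \<beta>\<bar> * \<beta> = \<bar>y - of_int j * \<beta>\<bar>"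
      using assms(1) by (simp add: abs_mult_pos abs_minus_commute left_diff_distrib)
    with j have "\<bar>of_int j - y / \<beta>\<bar> * \<beta> < e * \<beta>" by simp
    then have "dist (of_int j) (y / \<beta>) < e"
      by (simp only: dist_real_def mult_less_cancel_right_pos[OF assms(1)])
    from e(2)[OF this] show False by simp
  qed
  then show ?thesis using e assms by (intro exI[of _ "e * \<beta>"]) auto
qed

text \<open>Words longer than \<open>2 * N\<close> have probability at most 1/2, and near-lattice
  words of length at least \<open>K0\<close> at most 1/4. The remaining words, of probability at
  least 1/4, keep a distance of order \<open>N\<close> to the power -4. Its square enters
  \<open>redundancy_ge\<close>, and division by the delay gives the ninth power.\<close>

lemma redundancy_bound_of_summable:
  fixes p :: "nat \<Rightarrow> real"
  assumes m: "m \<ge> 2" and n: "n \<ge> 2"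
    and p: "sum p {1..m} = 1" "\<And>a. a \<in> {1..m} \<Longrightarrow> 0 < p a"
    and summ: "summable (near_mass m (ln (real n)) p)"
    and irr: "\<And>w j. set w \<subseteq> {1..m} \<Longrightarrow> w \<noteq> [] \<Longrightarrow> ln (word_prob p w) \<noteq> of_int j * ln (real n)"
  shows "\<exists>c>0. \<forall>W \<phi>. word_based_code m n W \<phi> \<and> decipherable W \<phi> \<and> average_delay p W \<ge> 1 \<longrightarrow>
    redundancy m n p W \<phi> \<ge> c / average_delay p W ^ 9"
proof -
  define \<beta> where "\<beta> = ln (real n)"
  have \<beta>: "\<beta> > 0" using n by (simp add: \<beta>_def)
  note summ = summ[folded \<beta>_def] and irr = irr[folded \<beta>_def]
  have pos: "word_prob p w > 0" if "set w \<subseteq> {1..m}" for w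
    using that p(2) by (intro word_prob_pos) auto
  have nm: "near_mass m \<beta> p K \<ge> 0" for K
    unfolding near_mass_def using pos by (intro sum_nonneg) (auto simp: words_def less_imp_le)
  \<comment> \<open>\<open>K0\<close>, and with it \<open>\<delta>\<close>, depends on the source
    and on \<open>n\<close> but not on the code, so the final constant is uniform over
    codes.\<close>
  obtain K0 where K0: "norm (\<Sum>i. near_mass m \<beta> p (i + K0)) < 1 / 4"
    using suminf_exist_split[OF _ summ, of "1 / 4"] by auto
  define X where "X = {w. set w \<subseteq> {1..m} \<and> length w \<le> K0} - {[]}"
  have finX: "finite X" unfolding X_def by (intro finite_Diff finite_lists_length_le) simp
  have "\<forall>w\<in>X. \<exists>\<delta>>0. \<not> near \<beta> \<delta> (ln (word_prob p w))"
    using irr by (intro ballI exists_not_near \<beta>) (auto simp: X_def)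
  then obtain d where d: "\<And>w. w \<in> X \<Longrightarrow> d w > 0 \<and> \<not> near \<beta> (d w) (ln (word_prob p w))" by metis
  \<comment> \<open>Inserting 1 covers an empty \<open>X\<close> and ensures
    \<open>\<delta> \<le> 1\<close>, as \<open>redundancy_ge\<close> needs.\<close>
  define \<delta> where "\<delta> = Min (insert 1 (d ` X))"
  have \<delta>: "0 < \<delta>" "\<delta> \<le> 1" "\<And>w. w \<in> X \<Longrightarrow> \<delta> \<le> d w"
    using finX d by (auto simp: \<delta>_def)
  \<comment> \<open>4096 is the product of 4 from the probability of \<open>V\<close>, 4 from
    \<open>exp_minus_ge\<close>, and 256 from the square of \<open>2 ^ 4\<close> in
    \<open>\<epsilon>\<close>.\<close>
  show ?thesis
  proof (intro exI[of _ "\<delta>\<^sup>2 / (4096 * \<beta>)"] conjI allI impI)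
    show "\<delta>\<^sup>2 / (4096 * \<beta>) > 0" using \<delta> \<beta> by simp
    fix W \<phi>
    define N where "N = average_delay p W"
    assume "word_based_code m n W \<phi> \<and> decipherable W \<phi> \<and> average_delay p W \<ge> 1"
    then have code: "word_based_code m n W \<phi>" and dec: "decipherable W \<phi>" and N: "N \<ge> 1"
      by (auto simp: N_def)
    have fin: "finite W" and W: "\<And>A. A \<in> W \<Longrightarrow> set A \<subseteq> {1..m}" "\<And>A. A \<in> W \<Longrightarrow> A \<noteq> []"
      using code by (auto simp: word_based_code_def)
    have Wpos: "word_prob p A > 0" if "A \<in> W" for A using pos W(1) that by blast
    have W1: "(\<Sum>A\<in>W. word_prob p A) = 1" by (rule sum_over_code(1)[OF code _ p(1)]) (use m in simp)
    define Long where "Long = {A \<in> W. real (length A) > 2 * N}"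
    define Bad where "Bad = {A \<in> W. length A \<ge> K0 \<and> near \<beta> (1 / real (length A) ^ 4) (ln (word_prob p A))}"
    define V where "V = W - (Long \<union> Bad)"
    have "(\<Sum>A\<in>Long. word_prob p A) * (2 * N) = (\<Sum>A\<in>Long. word_prob p A * (2 * N))"
      by (rule sum_distrib_right)
    also have "\<dots> \<le> (\<Sum>A\<in>Long. word_prob p A * real (length A))"
      using Wpos by (intro sum_mono mult_left_mono) (auto simp: Long_def less_imp_le)
    also have "\<dots> \<le> N" unfolding N_def average_delay_def
      using Wpos fin by (intro sum_mono2) (auto simp: Long_def less_imp_le)
    finally have Long: "(\<Sum>A\<in>Long. word_prob p A) \<le> 1 / 2" using N by (simp add: field_simps)
    define M where "M = Max (insert 0 (length ` W))"
    have M: "length A \<le> M" if "A \<in> W" for A using that fin by (auto simp: M_def)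
    \<comment> \<open>Code words of length \<open>K\<close> are among all words of length
      \<open>K\<close>, so grouping by length bounds this by the tail of the
      \<open>near_mass\<close> series.\<close>
    have "(\<Sum>A\<in>Bad. word_prob p A) = (\<Sum>K\<in>length ` Bad. \<Sum>A | A \<in> Bad \<and> length A = K. word_prob p A)"
      using fin by (intro sum.image_gen) (auto simp: Bad_def)
    also have "\<dots> \<le> (\<Sum>K\<in>length ` Bad. near_mass m \<beta> p K)"
    proof (rule sum_mono)
      fix K
      have "(\<Sum>A | A \<in> Bad \<and> length A = K. word_prob p A) =
          (\<Sum>A | A \<in> Bad \<and> length A = K. word_prob p A * of_bool (near \<beta> (1 / real K ^ 4) (ln (word_prob p A))))"
        by (intro sum.cong) (auto simp: Bad_def)
      also have "\<dots> \<le> near_mass m \<beta> p K"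
        unfolding near_mass_def using W(1) pos
        by (intro sum_mono2 finite_words) (auto simp: Bad_def words_def less_imp_le)
      finally show "(\<Sum>A | A \<in> Bad \<and> length A = K. word_prob p A) \<le> near_mass m \<beta> p K" .
    qed
    also have "\<dots> \<le> (\<Sum>K\<in>(\<lambda>i. i + K0) ` {..M}. near_mass m \<beta> p K)"
    proof (intro sum_mono2 nm)
      show "length ` Bad \<subseteq> (\<lambda>i. i + K0) ` {..M}"
      proof
        fix K assume "K \<in> length ` Bad"
        then have "K0 \<le> K" "K \<le> M" using M by (auto simp: Bad_def)
        then show "K \<in> (\<lambda>i. i + K0) ` {..M}" by (intro image_eqI[of _ _ "K - K0"]) auto
      qed
    qed simp
    also have "\<dots> = (\<Sum>i\<le>M. near_mass m \<beta> p (i + K0))"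
      by (subst sum.reindex) (auto simp: inj_on_def)
    also have "\<dots> \<le> (\<Sum>i. near_mass m \<beta> p (i + K0))"
      using nm summ by (intro sum_le_suminf) (auto simp: summable_iff_shift)
    also have "\<dots> \<le> 1 / 4" using K0 by simp
    finally have Bad: "(\<Sum>A\<in>Bad. word_prob p A) \<le> 1 / 4" .
    have "(\<Sum>A\<in>Long \<union> Bad. word_prob p A) \<le> (\<Sum>A\<in>Long. word_prob p A) + (\<Sum>A\<in>Bad. word_prob p A)"
      using fin Wpos sum_nonneg[of "Long \<inter> Bad" "word_prob p"]
      by (subst sum_Un) (auto simp: Long_def Bad_def less_imp_le)
    then have V: "(\<Sum>A\<in>V. word_prob p A) \<ge> 1 / 4"
      using Long Bad fin W1 unfolding V_def by (subst sum_diff) (auto simp: Long_def Bad_def)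
    \<comment> \<open>Small enough for both kinds of word in \<open>V\<close>: at most
      \<open>\<delta>\<close> for lengths below \<open>K0\<close>, and at most
      \<open>1 / real (length A) ^ 4\<close> for lengths from \<open>K0\<close> to
      \<open>2 * N\<close>.\<close>
    define \<epsilon> where "\<epsilon> = \<delta> / (2 * N) ^ 4"
    have N4: "(2 * N) ^ 4 \<ge> 1" using N by (intro one_le_power) simp
    have \<epsilon>: "0 < \<epsilon>" "\<epsilon> \<le> \<delta>" "\<epsilon> \<le> 1 / (2 * N) ^ 4"
      using \<delta> N N4 by (auto simp: \<epsilon>_def field_simps intro: mult_left_le)
    have far: "\<not> near \<beta> \<epsilon> (ln (word_prob p A))" if A: "A \<in> V" for A
    proof (cases "length A \<ge> K0")
      case True
      have "A \<noteq> []" using A W(2) by (auto simp: V_def)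
      then have "real (length A) > 0" by simp
      moreover have "real (length A) \<le> 2 * N" using A by (auto simp: V_def Long_def)
      ultimately have "1 / (2 * N) ^ 4 \<le> 1 / real (length A) ^ 4"
        using N by (intro divide_left_mono power_mono mult_pos_pos zero_less_power) auto
      with \<epsilon>(3) have "\<epsilon> \<le> 1 / real (length A) ^ 4" by simp
      then show ?thesis using A True near_mono by (auto simp: V_def Bad_def)
    next
      case False
      then have "A \<in> X" using A W by (auto simp: X_def V_def)
      then show ?thesis using d[of A] \<delta>(3)[of A] \<epsilon>(2) near_mono[of \<beta> \<epsilon> _ "d A"] by auto
    qed
    have "1 / 4 * (\<epsilon>\<^sup>2 / 4) \<le> (\<Sum>A\<in>V. word_prob p A) * (\<epsilon>\<^sup>2 / 4)"
      using V by (intro mult_right_mono) auto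
    also have "\<dots> \<le> redundancy m n p W \<phi> * N * \<beta>"
      unfolding \<beta>_def N_def
      using m \<epsilon> \<delta> N far by (intro redundancy_ge[OF code dec _ n p]) (auto simp: V_def N_def \<beta>_def)
    finally have "\<delta>\<^sup>2 / (4096 * \<beta>) / N ^ 9 \<le> redundancy m n p W \<phi>"
      using \<beta> N by (simp add: \<epsilon>_def field_simps power_mult_distrib power2_eq_square eval_nat_numeral)
    then show "\<delta>\<^sup>2 / (4096 * \<beta>) / average_delay p W ^ 9 \<le> redundancy m n p W \<phi>" by (simp add: N_def)
  qed
qed

theorem theorem4:
  fixes m n :: nat
  assumes "m \<ge> 2" and "n \<ge> 2"
  shows "AE x in lebesgue_dim (m - 1).
    (\<forall>i\<in>{1..<m}. 0 < x i) \<and> (\<Sum>i\<in>{1..<m}. x i) < 1 \<longrightarrow>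
    (\<exists>c N\<^sub>0 :: real. c > 0 \<and> N\<^sub>0 > 1 \<and>
      (\<forall>W \<phi>. word_based_code m n W \<phi> \<and> decipherable W \<phi> \<and>
          average_delay (source_prob m x) W \<ge> N\<^sub>0 \<longrightarrow>
        redundancy m n (source_prob m x) W \<phi>
          \<ge> c * average_delay (source_prob m x) W powi (-9)
              * ln (average_delay (source_prob m x) W) powi (-8)))"
  (is "AE x in _. ?P x")
proof -
  let ?\<beta> = "ln (real n)"
  let ?M = "Pi\<^sub>M {1..<m} (\<lambda>_. lborel :: real measure)"
  have "AE x in ?M. source_domain m x \<longrightarrow> summable (near_mass m ?\<beta> (source_prob m x))"
    using assms by (intro AE_summable_near_mass) auto
  \<comment> \<open>There are countably many pairs of a word and an integer, so the exceptional null
    sets can be united.\<close>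
  moreover have "AE x in ?M. \<forall>w. \<forall>j::int. set w \<subseteq> {1..m} \<and> w \<noteq> [] \<longrightarrow>
      source_domain m x \<longrightarrow> ln (word_prob (source_prob m x) w) \<noteq> of_int j * ?\<beta>"
    unfolding AE_all_countable
  proof (intro allI)
    fix w and j :: int
    show "AE x in ?M. set w \<subseteq> {1..m} \<and> w \<noteq> [] \<longrightarrow>
      source_domain m x \<longrightarrow> ln (word_prob (source_prob m x) w) \<noteq> of_int j * ?\<beta>"
    proof (cases "set w \<subseteq> {1..m} \<and> w \<noteq> []")
      case True
      then show ?thesis using AE_ln_word_prob_neq[OF assms(1), of w "of_int j * ?\<beta>"]
        by (auto elim!: eventually_mono)
    next
      case False
      then show ?thesis by (intro AE_I2) blast
    qed
  qed
  ultimately have "AE x in ?M. source_domain m x \<longrightarrow>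
    (\<exists>c>0. \<forall>W \<phi>. word_based_code m n W \<phi> \<and> decipherable W \<phi> \<and> average_delay (source_prob m x) W \<ge> 1 \<longrightarrow>
      redundancy m n (source_prob m x) W \<phi> \<ge> c / average_delay (source_prob m x) W ^ 9)"
  proof eventually_elim
    fix x assume summ: "source_domain m x \<longrightarrow> summable (near_mass m ?\<beta> (source_prob m x))"
      and irr: "\<forall>w. \<forall>j::int. set w \<subseteq> {1..m} \<and> w \<noteq> [] \<longrightarrow>
        source_domain m x \<longrightarrow> ln (word_prob (source_prob m x) w) \<noteq> of_int j * ?\<beta>"
    show "source_domain m x \<longrightarrow> (\<exists>c>0. \<forall>W \<phi>. word_based_code m n W \<phi> \<and> decipherable W \<phi> \<and> average_delay (source_prob m x) W \<ge> 1 \<longrightarrow>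
      redundancy m n (source_prob m x) W \<phi> \<ge> c / average_delay (source_prob m x) W ^ 9)"
    proof
      assume dom: "source_domain m x"
      have "{1..m} = insert m {1..<m}" using assms by auto
      then have "sum (source_prob m x) {1..m} = 1" by (simp add: source_prob_def)
      moreover have "source_prob m x a > 0" if "a \<in> {1..m}" for a
        using dom that by (auto simp: source_domain_def source_prob_def)
      ultimately show "\<exists>c>0. \<forall>W \<phi>. word_based_code m n W \<phi> \<and> decipherable W \<phi> \<and> average_delay (source_prob m x) W \<ge> 1 \<longrightarrow>
        redundancy m n (source_prob m x) W \<phi> \<ge> c / average_delay (source_prob m x) W ^ 9"
        using assms summ irr dom by (intro redundancy_bound_of_summable) auto
    qed
  qed
  moreover have "lebesgue_dim (m - 1) = completion ?M"
  proof -
    have "{1..m - 1} = {1..<m}" using assms by auto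
    then show ?thesis by (simp add: lebesgue_dim_def)
  qed
  ultimately have "AE x in lebesgue_dim (m - 1). source_domain m x \<longrightarrow>
    (\<exists>c>0. \<forall>W \<phi>. word_based_code m n W \<phi> \<and> decipherable W \<phi> \<and> average_delay (source_prob m x) W \<ge> 1 \<longrightarrow>
      redundancy m n (source_prob m x) W \<phi> \<ge> c / average_delay (source_prob m x) W ^ 9)"
    by (simp only: AE_completion)
  then show ?thesis
  proof (rule eventually_mono)
    fix x
    assume *: "source_domain m x \<longrightarrow>
      (\<exists>c>0. \<forall>W \<phi>. word_based_code m n W \<phi> \<and> decipherable W \<phi> \<and> average_delay (source_prob m x) W \<ge> 1 \<longrightarrow>
        redundancy m n (source_prob m x) W \<phi> \<ge> c / average_delay (source_prob m x) W ^ 9)"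
    show "?P x"
    proof
      assume "(\<forall>i\<in>{1..<m}. 0 < x i) \<and> (\<Sum>i\<in>{1..<m}. x i) < 1"
      with * obtain c where c: "c > 0" and bound: "\<And>W \<phi>. word_based_code m n W \<phi> \<Longrightarrow> decipherable W \<phi> \<Longrightarrow>
          average_delay (source_prob m x) W \<ge> 1 \<Longrightarrow>
          redundancy m n (source_prob m x) W \<phi> \<ge> c / average_delay (source_prob m x) W ^ 9"
        unfolding source_domain_def by blast
      show "\<exists>c N\<^sub>0 :: real. c > 0 \<and> N\<^sub>0 > 1 \<and>
        (\<forall>W \<phi>. word_based_code m n W \<phi> \<and> decipherable W \<phi> \<and>
            average_delay (source_prob m x) W \<ge> N\<^sub>0 \<longrightarrow>
          redundancy m n (source_prob m x) W \<phi>
            \<ge> c * average_delay (source_prob m x) W powi (-9)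
                * ln (average_delay (source_prob m x) W) powi (-8))"
      proof (rule exI[of _ c], rule exI[of _ 3], intro conjI allI impI c)
        fix W \<phi>
        define N where "N = average_delay (source_prob m x) W"
        assume "word_based_code m n W \<phi> \<and> decipherable W \<phi> \<and> average_delay (source_prob m x) W \<ge> 3"
        then have W: "word_based_code m n W \<phi>" "decipherable W \<phi>" and N: "N \<ge> 3" by (auto simp: N_def)
        \<comment> \<open>The threshold 3 exceeds \<open>exp 1\<close>, so
          \<open>ln N \<ge> 1\<close> and the logarithmic factor only weakens the bound
          \<open>c / N ^ 9\<close> already available.\<close>
        have "exp 1 \<le> N" using exp_le N by linarith
        then have "ln N \<ge> 1" using N by (subst ln_ge_iff) auto
        then have "ln N ^ 8 \<ge> 1" by (rule one_le_power)
        then have "inverse (ln N ^ 8) \<le> 1" by (simp add: inverse_le_1_iff)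
        then have "c / N ^ 9 * inverse (ln N ^ 8) \<le> c / N ^ 9"
          using c N by (intro mult_left_le) auto
        also have "\<dots> \<le> redundancy m n (source_prob m x) W \<phi>"
          using bound[OF W] N by (simp add: N_def)
        finally show "c * average_delay (source_prob m x) W powi (-9)
                * ln (average_delay (source_prob m x) W) powi (-8) \<le> redundancy m n (source_prob m x) W \<phi>"
          by (simp add: N_def power_int_minus divide_inverse)
      qed simp
    qed
  qed
qed

end
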